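(* Let $k$ be a natural number. There exists an $O(n^3)$-time algorithm which, given a graph $G$ with $n$ vertices, decides whether $G$ is a $k$-threshold graph.
   Context: Graphs are finite and simple. Let $C=\{1,\ldots,k\}$ be a set of colors; a coloring of $G=(V,E)$ is any map $c:V\to C$ (no properness condition). A graph $G=(V,E)$ is a $k$-threshold graph if there is a coloring of $G$ with $k$ colors such that for every nonempty set $W\subseteq V$ the induced graph $G[W]$ has a vertex $x$ which is either isolated in $G[W]$, or is adjacent to exactly all vertices of color $i$ in $W\setminus\{x\}$ for some color $i$ (and to no other vertices of $W$). *)

theory Defs
  imports
    Complex_Main
    "HOL-Library.FuncSet"
    "HOL-Library.Landau_Symbols"
    "Graph_Theory.Graph_Theory"
begin

section \<open>k-threshold graphs\<close>

text \<open>
  A finite simple graph is a \<open>pair_graph\<close> of the AFP graph library: a finite vertex set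
  with a symmetric, irreflexive set of arcs, an undirected edge being a pair of opposite arcs.
\<close>

definition neighbours :: "('a, 'b) pre_digraph \<Rightarrow> 'a \<Rightarrow> 'a set" where
  "neighbours G x = {y. x \<rightarrow>\<^bsub>G\<^esub> y}"

definition k_threshold_graph :: "nat \<Rightarrow> 'a pair_pre_digraph \<Rightarrow> bool" where
  "k_threshold_graph k G \<longleftrightarrow> pair_graph G \<and>
     (\<exists>c \<in> pverts G \<rightarrow> {1..k}. \<forall>W \<subseteq> pverts G. W \<noteq> {} \<longrightarrow>
        (\<exists>x \<in> W. neighbours (with_proj G \<restriction> W) x = {} \<or>
           (\<exists>i \<in> {1..k}. neighbours (with_proj G \<restriction> W) x = {y \<in> W - {x}. c y = i})))"


section \<open>Random access machines\<close>

text \<open>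
  The machine model is the unit-cost random access machine of Cook and Reckhow: addition and
  subtraction are the only arithmetic, addressing may be indirect, and the input is read word by
  word from a tape (reading past its end yields \<open>0\<close>).  Registers hold natural numbers, initially
  \<open>0\<close>, and subtraction is truncated.  A machine halts by leaving its program; a halted
  configuration is a fixed point of \<open>ram_step\<close>.
\<close>

datatype ram_instr =
    Set_Const nat nat      \<comment> \<open>\<open>R[i] := c\<close>\<close>
  | Set_Add nat nat nat    \<comment> \<open>\<open>R[i] := R[j] + R[l]\<close>\<close>
  | Set_Sub nat nat nat    \<comment> \<open>\<open>R[i] := R[j] - R[l]\<close>\<close>
  | Load nat nat           \<comment> \<open>\<open>R[i] := R[R[j]]\<close>\<close>
  | Store nat nat          \<comment> \<open>\<open>R[R[i]] := R[j]\<close>\<close>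
  | Jump_Pos nat nat       \<comment> \<open>\<open>if R[j] > 0 then goto p\<close>, written \<open>Jump_Pos j p\<close>\<close>
  | Read nat               \<comment> \<open>\<open>R[i] := next input word\<close>\<close>

type_synonym ram_program = "ram_instr list"

text \<open>A configuration is a triple of program counter, unread input, and registers.\<close>

type_synonym ram_config = "nat \<times> nat list \<times> (nat \<Rightarrow> nat)"

fun exec_instr :: "ram_instr \<Rightarrow> ram_config \<Rightarrow> ram_config" where
  "exec_instr (Set_Const i c) (pc, xs, R) = (Suc pc, xs, R(i := c))"
| "exec_instr (Set_Add i j l) (pc, xs, R) = (Suc pc, xs, R(i := R j + R l))"
| "exec_instr (Set_Sub i j l) (pc, xs, R) = (Suc pc, xs, R(i := R j - R l))"
| "exec_instr (Load i j) (pc, xs, R) = (Suc pc, xs, R(i := R (R j)))"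
| "exec_instr (Store i j) (pc, xs, R) = (Suc pc, xs, R(R i := R j))"
| "exec_instr (Jump_Pos j p) (pc, xs, R) = (if R j > 0 then p else Suc pc, xs, R)"
| "exec_instr (Read i) (pc, [], R) = (Suc pc, [], R(i := 0))"
| "exec_instr (Read i) (pc, x # xs, R) = (Suc pc, xs, R(i := x))"

fun registers :: "ram_config \<Rightarrow> nat \<Rightarrow> nat" where
  "registers (pc, xs, R) = R"

fun halted :: "ram_program \<Rightarrow> ram_config \<Rightarrow> bool" where
  "halted P (pc, xs, R) \<longleftrightarrow> length P \<le> pc"

definition ram_step :: "ram_program \<Rightarrow> ram_config \<Rightarrow> ram_config" where
  "ram_step P s = (if halted P s then s else exec_instr (P ! fst s) s)"

definition ram_run :: "ram_program \<Rightarrow> nat list \<Rightarrow> nat \<Rightarrow> ram_config" where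
  "ram_run P xs t = (ram_step P ^^ t) (0, xs, \<lambda>_. 0)"


section \<open>Deciding graph properties\<close>

definition input_graph :: "nat \<Rightarrow> nat pair_pre_digraph \<Rightarrow> bool" where
  "input_graph n G \<longleftrightarrow> pair_graph G \<and> pverts G = {..<n}"

text \<open>
  A graph on the vertices \<open>0, \<dots>, n - 1\<close> is passed to a machine as the number \<open>n\<close> followed by the
  adjacency matrix, row by row.
\<close>

definition graph_input :: "nat \<Rightarrow> nat pair_pre_digraph \<Rightarrow> nat list" where
  "graph_input n G = n # concat (map (\<lambda>u. map (\<lambda>v. of_bool ((u, v) \<in> parcs G)) [0..<n]) [0..<n])"

definition ram_decides :: "ram_program \<Rightarrow> (nat pair_pre_digraph \<Rightarrow> bool) \<Rightarrow> bool" where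
  "ram_decides P Q \<longleftrightarrow> (\<forall>n G. input_graph n G \<longrightarrow>
     (\<exists>t. halted P (ram_run P (graph_input n G) t) \<and>
          registers (ram_run P (graph_input n G) t) 0 = of_bool (Q G)))"

definition ram_time :: "ram_program \<Rightarrow> (nat \<Rightarrow> real) \<Rightarrow> bool" where
  "ram_time P f \<longleftrightarrow> (\<exists>T :: nat \<Rightarrow> nat. (\<lambda>n. real (T n)) \<in> O(f) \<and>
     (\<forall>n G. input_graph n G \<longrightarrow> (\<exists>t \<le> T n. halted P (ram_run P (graph_input n G) t))))"

text \<open>
  Charging one unit per instruction is only realistic if registers are words of \<open>O(log n)\<close> bits,
  that is, if their contents stay polynomially bounded in \<open>n\<close> throughout the computation.
\<close>

definition ram_log_words :: "ram_program \<Rightarrow> bool" where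
  "ram_log_words P \<longleftrightarrow> (\<exists>(W :: nat \<Rightarrow> nat) d. (\<lambda>n. real (W n)) \<in> O(\<lambda>n. real n ^ d) \<and>
     (\<forall>n G t a. input_graph n G \<longrightarrow> registers (ram_run P (graph_input n G) t) a \<le> W n))"

end

theory Submission
  imports Defs "HOL-Library.Sublist" "HOL-Library.Infinite_Set"
begin

text \<open>
  Eliminating the vertices one by one shows that a graph is k-threshold iff its vertices can be
  ordered and labelled with finitely many letters, a letter being a colour together with the
  colour of the later neighbours, such that the letters of two vertices determine whether they are
  adjacent.  Such a graph is thus described by a word.

  Vertices are inserted one at a time.  Suppose a word of the current graph is known, each position
  carrying one bit for the adjacency to the new vertex and possibly a mark prescribing its new
  letter.  The annotated words for which the enlarged graph has a representation respecting the
  marks are closed under subsequences, since passing to a subsequence is passing to an induced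
  subgraph.  By Higman's lemma such a language is decided by a finite automaton, which is built
  into the program.  Running it once per position and letter finds all new letters in quadratic
  time.  Given the letters, a new order is a topological sorting of the relation ``cannot precede'',
  again in quadratic time.  Inserting all vertices takes cubic time.
\<close>

section \<open>Higman's lemma and languages closed under subsequences\<close>

definition bad_seq :: "'a set \<Rightarrow> (nat \<Rightarrow> 'a list) \<Rightarrow> bool" where
  "bad_seq X f \<longleftrightarrow> (\<forall>i. f i \<in> lists X) \<and> (\<forall>i j. i < j \<longrightarrow> \<not> subseq (f i) (f j))"

lemma minimal_bad_seq:
  assumes "bad_seq X f"
  obtains g where "bad_seq X g"
    and "\<And>n h. bad_seq X h \<Longrightarrow> (\<And>i. i < n \<Longrightarrow> h i = g i) \<Longrightarrow> length (g n) \<le> length (h n)"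
proof -
  define P where "P n F \<longleftrightarrow> bad_seq X F \<and>
      (n = 0 \<longrightarrow> (\<forall>h. bad_seq X h \<longrightarrow> length (F 0) \<le> length (h 0)))" for n :: nat and F
  define Q where "Q n F F' \<longleftrightarrow> (\<forall>i\<le>n. F' i = F i) \<and>
      (\<forall>h. bad_seq X h \<longrightarrow> (\<forall>i\<le>n. h i = F i) \<longrightarrow> length (F' (Suc n)) \<le> length (h (Suc n)))"
    for n :: nat and F F' :: "nat \<Rightarrow> 'a list"
  have "\<exists>F. \<forall>n. P n (F n) \<and> Q n (F n) (F (Suc n))"
  proof (rule dependent_nat_choice)
    show "\<exists>F. P 0 F"
      using ex_has_least_nat[of "bad_seq X" f "\<lambda>h. length (h 0)"] assms unfolding P_def by blast
  next
    fix F n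
    assume "P n F"
    then show "\<exists>F'. P (Suc n) F' \<and> Q n F F'"
      using ex_has_least_nat[of "\<lambda>h. bad_seq X h \<and> (\<forall>i\<le>n. h i = F i)" F "\<lambda>h. length (h (Suc n))"]
      unfolding P_def Q_def by auto
  qed
  then obtain F where P: "\<And>n. P n (F n)" and Q: "\<And>n. Q n (F n) (F (Suc n))"
    by blast
  define g where "g n = F n n" for n
  have agree: "F (m + d) i = F m i" if "i \<le> m" for m d i
    using that Q unfolding Q_def by (induction d) auto
  have g: "F m i = g i" if "i \<le> m" for m i
    using agree[of i i "m - i"] that by (simp add: g_def)
  show thesis
  proof (rule that[of g])
    show "bad_seq X g"
      using P g unfolding bad_seq_def P_def by (metis less_imp_le order_refl)
  next
    fix n h
    assume h: "bad_seq X h" "\<And>i. i < n \<Longrightarrow> h i = g i"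
    show "length (g n) \<le> length (h n)"
    proof (cases n)
      case 0
      then show ?thesis using P[of 0] h by (simp add: P_def g_def)
    next
      case (Suc m)
      have "\<forall>i\<le>m. h i = F m i" using h(2) g Suc by (metis le_imp_less_Suc)
      then show ?thesis using Q[of m] h(1) Suc unfolding Q_def by (simp add: g_def)
    qed
  qed
qed

theorem higman:
  fixes f :: "nat \<Rightarrow> 'a list"
  assumes "finite X" "\<And>i. f i \<in> lists X"
  shows "\<exists>i j. i < j \<and> subseq (f i) (f j)"
proof (rule ccontr)
  assume "\<not> ?thesis"
  then have "bad_seq X f"
    using assms by (auto simp: bad_seq_def)
  then obtain g where bad: "bad_seq X g"
    and min: "\<And>n h. bad_seq X h \<Longrightarrow> (\<And>i. i < n \<Longrightarrow> h i = g i) \<Longrightarrow> length (g n) \<le> length (h n)"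
    by (rule minimal_bad_seq) blast
  have nonempty: "g i \<noteq> []" for i
  proof
    assume "g i = []"
    then have "subseq (g i) (g (Suc i))" by simp
    then show False using bad unfolding bad_seq_def by blast
  qed
  have "hd (g i) \<in> X" for i
    using bad nonempty[of i] unfolding bad_seq_def
    by (metis in_listsD list.set_sel(1))
  then have "finite (range (\<lambda>i. hd (g i)))"
    using \<open>finite X\<close> by (blast intro: finite_subset)
  from pigeonhole_infinite[OF _ this] obtain i0 where inf: "infinite {i. hd (g i) = hd (g i0)}"
    by auto
  define a where "a = hd (g i0)"
  obtain \<phi> :: "nat \<Rightarrow> nat" where \<phi>: "strict_mono \<phi>" "\<And>i. hd (g (\<phi> i)) = a"
    using infinite_enumerate[OF inf] by (auto simp: a_def)
  define h where "h i = (if i < \<phi> 0 then g i else tl (g (\<phi> (i - \<phi> 0))))" for i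
  have cons: "g (\<phi> i) = a # tl (g (\<phi> i))" for i
    using nonempty \<phi>(2) by (metis list.collapse)
  have "bad_seq X h"
    unfolding bad_seq_def
  proof (intro conjI allI impI)
    fix i
    have "tl (g m) \<in> lists X" for m
      using bad unfolding bad_seq_def by (metis list.sel(2) in_lists_conv_set list.set_sel(2))
    then show "h i \<in> lists X" using bad by (simp add: h_def bad_seq_def)
  next
    fix i j :: nat
    assume ij: "i < j"
    have g': "\<not> subseq (g i) (g j)" if "i < j" for i j
      using bad that by (simp add: bad_seq_def)
    consider "j < \<phi> 0" | "i < \<phi> 0" "\<phi> 0 \<le> j" | "\<phi> 0 \<le> i" by linarith
    then show "\<not> subseq (h i) (h j)"
    proof cases
      case 1
      then show ?thesis using g' ij by (simp add: h_def)
    next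
      case 2
      have "\<phi> 0 \<le> \<phi> (j - \<phi> 0)" using \<phi>(1) by (simp add: strict_mono_less_eq)
      then have "\<not> subseq (g i) (g (\<phi> (j - \<phi> 0)))" using 2 by (intro g') simp
      then show ?thesis using 2 cons[of "j - \<phi> 0"]
        by (metis h_def list_emb_Cons not_le)
    next
      case 3
      have "\<phi> (i - \<phi> 0) < \<phi> (j - \<phi> 0)" using \<phi>(1) 3 ij by (simp add: strict_mono_less)
      then have "\<not> subseq (g (\<phi> (i - \<phi> 0))) (g (\<phi> (j - \<phi> 0)))" by (rule g')
      then have "\<not> subseq (tl (g (\<phi> (i - \<phi> 0)))) (tl (g (\<phi> (j - \<phi> 0))))"
        using cons by (metis subseq_Cons2)
      then show ?thesis using 3 ij by (simp add: h_def)
    qed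
  qed
  then have "length (g (\<phi> 0)) \<le> length (h (\<phi> 0))"
    by (rule min) (simp add: h_def)
  then show False using nonempty[of "\<phi> 0"] by (cases "g (\<phi> 0)") (simp_all add: h_def)
qed

definition minimal_excluded :: "'a set \<Rightarrow> ('a list \<Rightarrow> bool) \<Rightarrow> 'a list set" where
  "minimal_excluded X L =
    {w \<in> lists X. \<not> L w \<and> (\<forall>u \<in> lists X. \<not> L u \<longrightarrow> subseq u w \<longrightarrow> u = w)}"

lemma finite_minimal_excluded:
  assumes "finite X"
  shows "finite (minimal_excluded X L)"
proof (rule ccontr)
  assume "infinite (minimal_excluded X L)"
  then obtain f :: "nat \<Rightarrow> 'a list" where f: "inj f" "range f \<subseteq> minimal_excluded X L"
    using infinite_countable_subset by blast
  then have "f i \<in> lists X" for i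
    unfolding minimal_excluded_def by blast
  from higman[OF assms this] obtain i j where "i < j" "subseq (f i) (f j)" by blast
  then have "f i = f j" using f(2) unfolding minimal_excluded_def by blast
  then show False using \<open>i < j\<close> f(1) by (simp add: inj_eq)
qed

lemma subseq_minimal_excluded:
  assumes "w \<in> lists X" "\<not> L w"
  shows "\<exists>u \<in> minimal_excluded X L. subseq u w"
  using assms
proof (induction w rule: length_induct)
  case (1 w)
  show ?case
  proof (cases "w \<in> minimal_excluded X L")
    case False
    then obtain u where u: "u \<in> lists X" "\<not> L u" "subseq u w" "u \<noteq> w"
      using 1 unfolding minimal_excluded_def by blast
    then have "length u < length w"
      by (metis list_emb_length order_le_less subseq_same_length)
    then obtain v where "v \<in> minimal_excluded X L" "subseq v u" using 1 u by blast
    then show ?thesis using u(3) subseq_order.order_trans by blast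
  qed auto
qed

lemma subseq_snoc_iff:
  "subseq g (w @ [a]) \<longleftrightarrow> subseq g w \<or> (g \<noteq> [] \<and> last g = a \<and> subseq (butlast g) w)"
proof
  assume "subseq g (w @ [a])"
  then obtain g1 g2 where g: "g = g1 @ g2" "subseq g1 w" "subseq g2 [a]"
    using subseq_append_iff by metis
  have "g2 = [] \<or> g2 = [a]"
    using g(3) by (cases g2) (auto split: if_splits)
  then show "subseq g w \<or> (g \<noteq> [] \<and> last g = a \<and> subseq (butlast g) w)"
    using g by auto
next
  assume "subseq g w \<or> (g \<noteq> [] \<and> last g = a \<and> subseq (butlast g) w)"
  then show "subseq g (w @ [a])"
  proof
    assume "g \<noteq> [] \<and> last g = a \<and> subseq (butlast g) w"
    then show ?thesis
      by (metis append_butlast_last_id list_emb_append_mono subseq_order.order_refl)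
  qed (simp add: subseq_rev_drop_many)
qed

text \<open>
  The automaton remembers which prefixes of the minimal excluded words are subsequences of the
  input read so far.
\<close>

theorem subseq_closed_automaton:
  fixes L :: "'b \<Rightarrow> 'a list \<Rightarrow> bool"
  assumes X: "finite X" and J: "finite J"
    and closed: "\<And>j u w. j \<in> J \<Longrightarrow> subseq u w \<Longrightarrow> L j w \<Longrightarrow> L j u"
  obtains m :: nat and q0 and \<delta> :: "nat \<Rightarrow> 'a \<Rightarrow> nat" and acc
  where "q0 < m" "\<And>q a. q < m \<Longrightarrow> \<delta> q a < m"
    and "\<And>j w. j \<in> J \<Longrightarrow> w \<in> lists X \<Longrightarrow> acc (foldl \<delta> q0 w) j \<longleftrightarrow> L j w"
proof -
  define F where "F = (\<Union>j\<in>J. minimal_excluded X (L j))"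
  define Pf where "Pf = (\<Union>f\<in>F. set (prefixes f))"
  have fin: "finite (Pow Pf)"
    using X J by (simp add: F_def Pf_def finite_minimal_excluded)
  define S where "S w = {g \<in> Pf. subseq g w}" for w
  define step where
    "step T a = {g \<in> Pf. g \<in> T \<or> g \<noteq> [] \<and> last g = a \<and> butlast g \<in> T}" for T a
  have butlast: "butlast g \<in> Pf" if "g \<in> Pf" for g
    using that unfolding Pf_def by (auto intro: prefix_order.order_trans[OF prefixeq_butlast])
  have S_snoc: "S (w @ [a]) = step (S w) a" for w a
    unfolding S_def step_def by (auto simp: subseq_snoc_iff butlast)
  obtain e where e: "bij_betw e (Pow Pf) {0..<card (Pow Pf)}"
    using ex_bij_betw_finite_nat[OF fin] by blast
  define d where "d = the_inv_into (Pow Pf) e"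
  have d: "d (e T) = T" if "T \<subseteq> Pf" for T
    using e that unfolding d_def bij_betw_def by (simp add: the_inv_into_f_f)
  have e_less: "e T < card (Pow Pf)" if "T \<subseteq> Pf" for T
    using bij_betwE[OF e] that by auto
  define \<delta> where "\<delta> q a = e (step (d q) a)" for q a
  have S_sub: "S w \<subseteq> Pf" for w by (auto simp: S_def)
  have run: "foldl \<delta> (e (S [])) w = e (S w)" for w
    by (induction w rule: rev_induct) (simp_all add: \<delta>_def d S_sub S_snoc)
  show thesis
  proof (rule that[of "e (S [])" "card (Pow Pf)" \<delta> "\<lambda>q j. d q \<inter> minimal_excluded X (L j) = {}"])
    show "e (S []) < card (Pow Pf)" by (rule e_less[OF S_sub])
    show "\<delta> q a < card (Pow Pf)" for q a
      unfolding \<delta>_def by (rule e_less) (auto simp: step_def)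
    fix j w
    assume j: "j \<in> J" and w: "w \<in> lists X"
    have "minimal_excluded X (L j) \<subseteq> Pf"
      using j unfolding Pf_def F_def by fastforce
    then have "S w \<inter> minimal_excluded X (L j) = {} \<longleftrightarrow>
        (\<forall>u \<in> minimal_excluded X (L j). \<not> subseq u w)"
      unfolding S_def by blast
    also have "\<dots> \<longleftrightarrow> L j w"
      using subseq_minimal_excluded[OF w, of "L j"] closed[OF j]
      unfolding minimal_excluded_def by blast
    finally show "d (foldl \<delta> (e (S [])) w) \<inter> minimal_excluded X (L j) = {} \<longleftrightarrow> L j w"
      by (simp add: run d S_sub)
  qed
qed

section \<open>A loop language and its compilation to random access machines\<close>

datatype var =
  Out | Size | Zero | Fail | Cur | Next | PosP | PosQ | Scan | Round | Val | State | Lab | Adj | Mark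
  | Found | Edge | Bad | Count | Const_Tmp

datatype arr = Row | Vertex | Adjacent | Label | Marking | Degree | Removed | New_Vertex | New_Label

datatype com =
    SKIP
  | Const var nat
  | Copy var var
  | Inc var
  | Dec var
  | Get var arr var
  | Put arr var var
  | Input var
  | Seq com com  (infixr \<open>;;\<close> 60)
  | IfLess var var com com
  | For var com

record store =
  inp :: "nat list"
  sc :: "var \<Rightarrow> nat"
  ar :: "arr \<Rightarrow> nat \<Rightarrow> nat"

abbreviation set_var :: "var \<Rightarrow> nat \<Rightarrow> store \<Rightarrow> store" where
  "set_var x v s \<equiv> s\<lparr>sc := (sc s)(x := v)\<rparr>"

text \<open>
  All loops run through \<open>0, \<dots>, n - 1\<close>, where \<open>n\<close> is the value of \<open>Size\<close>, and \<open>Inc\<close> saturates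
  at \<open>n\<close>.  Hence every program terminates, its running time is at most a polynomial in \<open>n\<close> of
  degree its loop depth, and its values are at most \<open>n\<close>, the constants of the program and the
  words of the input.
\<close>

primrec exec :: "com \<Rightarrow> store \<Rightarrow> store" where
  "exec SKIP s = s"
| "exec (Const x c) s = set_var x c s"
| "exec (Copy x y) s = set_var x (sc s y) s"
| "exec (Inc x) s = set_var x (if sc s x < sc s Size then Suc (sc s x) else sc s x) s"
| "exec (Dec x) s = set_var x (sc s x - 1) s"
| "exec (Get x a y) s = set_var x (ar s a (sc s y)) s"
| "exec (Put a y x) s = s\<lparr>ar := (ar s)(a := (ar s a)(sc s y := sc s x))\<rparr>"
| "exec (Input x) s = (case inp s of [] \<Rightarrow> set_var x 0 s | v # vs \<Rightarrow> set_var x v (s\<lparr>inp := vs\<rparr>))"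
| "exec (c1 ;; c2) s = exec c2 (exec c1 s)"
| "exec (IfLess x y c1 c2) s = (if sc s x < sc s y then exec c1 s else exec c2 s)"
| "exec (For x c) s =
    set_var x (sc s Size) (fold (\<lambda>j s. exec c (set_var x j s)) [0..<sc s Size] s)"

primrec mod_vars :: "com \<Rightarrow> var set" where
  "mod_vars SKIP = {}"
| "mod_vars (Const x c) = {x}"
| "mod_vars (Copy x y) = {x}"
| "mod_vars (Inc x) = {x}"
| "mod_vars (Dec x) = {x}"
| "mod_vars (Get x a y) = {x}"
| "mod_vars (Put a y x) = {}"
| "mod_vars (Input x) = {x}"
| "mod_vars (c1 ;; c2) = mod_vars c1 \<union> mod_vars c2"
| "mod_vars (IfLess x y c1 c2) = mod_vars c1 \<union> mod_vars c2"
| "mod_vars (For x c) = insert x (mod_vars c)"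

primrec mod_arrs :: "com \<Rightarrow> arr set" where
  "mod_arrs SKIP = {}"
| "mod_arrs (Const x c) = {}"
| "mod_arrs (Copy x y) = {}"
| "mod_arrs (Inc x) = {}"
| "mod_arrs (Dec x) = {}"
| "mod_arrs (Get x a y) = {}"
| "mod_arrs (Put a y x) = {a}"
| "mod_arrs (Input x) = {}"
| "mod_arrs (c1 ;; c2) = mod_arrs c1 \<union> mod_arrs c2"
| "mod_arrs (IfLess x y c1 c2) = mod_arrs c1 \<union> mod_arrs c2"
| "mod_arrs (For x c) = mod_arrs c"

primrec input_free :: "com \<Rightarrow> bool" where
  "input_free SKIP = True"
| "input_free (Const x c) = True"
| "input_free (Copy x y) = True"
| "input_free (Inc x) = True"
| "input_free (Dec x) = True"
| "input_free (Get x a y) = True"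
| "input_free (Put a y x) = True"
| "input_free (Input x) = False"
| "input_free (c1 ;; c2) = (input_free c1 \<and> input_free c2)"
| "input_free (IfLess x y c1 c2) = (input_free c1 \<and> input_free c2)"
| "input_free (For x c) = input_free c"

primrec wf_com :: "com \<Rightarrow> bool" where
  "wf_com SKIP = True"
| "wf_com (Const x c) = (x \<noteq> Size)"
| "wf_com (Copy x y) = (x \<noteq> Size)"
| "wf_com (Inc x) = (x \<noteq> Size)"
| "wf_com (Dec x) = (x \<noteq> Size)"
| "wf_com (Get x a y) = (x \<noteq> Size)"
| "wf_com (Put a y x) = True"
| "wf_com (Input x) = (x \<noteq> Size)"
| "wf_com (c1 ;; c2) = (wf_com c1 \<and> wf_com c2)"
| "wf_com (IfLess x y c1 c2) = (wf_com c1 \<and> wf_com c2)"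
| "wf_com (For x c) = (wf_com c \<and> x \<noteq> Size \<and> x \<notin> mod_vars c)"

primrec loop_depth :: "com \<Rightarrow> nat" where
  "loop_depth SKIP = 0"
| "loop_depth (Const x c) = 0"
| "loop_depth (Copy x y) = 0"
| "loop_depth (Inc x) = 0"
| "loop_depth (Dec x) = 0"
| "loop_depth (Get x a y) = 0"
| "loop_depth (Put a y x) = 0"
| "loop_depth (Input x) = 0"
| "loop_depth (c1 ;; c2) = max (loop_depth c1) (loop_depth c2)"
| "loop_depth (IfLess x y c1 c2) = max (loop_depth c1) (loop_depth c2)"
| "loop_depth (For x c) = Suc (loop_depth c)"

primrec max_const :: "com \<Rightarrow> nat" where
  "max_const SKIP = 0"
| "max_const (Const x c) = c"
| "max_const (Copy x y) = 0"
| "max_const (Inc x) = 0"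
| "max_const (Dec x) = 0"
| "max_const (Get x a y) = 0"
| "max_const (Put a y x) = 0"
| "max_const (Input x) = 0"
| "max_const (c1 ;; c2) = max (max_const c1) (max_const c2)"
| "max_const (IfLess x y c1 c2) = max (max_const c1) (max_const c2)"
| "max_const (For x c) = max_const c"

lemma fold_invariant_upt:
  assumes "I 0 s" "\<And>j s. j < n \<Longrightarrow> I j s \<Longrightarrow> I (Suc j) (f j s)"
  shows "I n (fold f [0..<n] s)"
proof -
  have "m \<le> n \<Longrightarrow> I m (fold f [0..<m] s)" for m
    using assms by (induction m) auto
  then show ?thesis by blast
qed

lemma wf_com_Size: "wf_com c \<Longrightarrow> Size \<notin> mod_vars c"
  by (induction c) auto

lemma exec_var: "x \<notin> mod_vars c \<Longrightarrow> sc (exec c s) x = sc s x"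
proof (induction c arbitrary: s)
  case (For y c)
  have "sc (fold (\<lambda>j s. exec c (set_var y j s)) [0..<n] s) x = sc s x" for n
    by (rule fold_invariant_upt[where I = "\<lambda>j s'. sc s' x = sc s x"]) (use For in auto)
  then show ?case using For.prems by simp
qed (auto split: list.split)

lemma exec_arr: "a \<notin> mod_arrs c \<Longrightarrow> ar (exec c s) a = ar s a"
proof (induction c arbitrary: s)
  case (For y c)
  have "ar (fold (\<lambda>j s. exec c (set_var y j s)) [0..<n] s) a = ar s a" for n
    by (rule fold_invariant_upt[where I = "\<lambda>j s'. ar s' a = ar s a"]) (use For in auto)
  then show ?case by simp
qed (auto split: list.split)

lemma exec_inp: "input_free c \<Longrightarrow> inp (exec c s) = inp s"
proof (induction c arbitrary: s)
  case (For y c)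
  have "inp (fold (\<lambda>j s. exec c (set_var y j s)) [0..<n] s) = inp s" for n
    by (rule fold_invariant_upt[where I = "\<lambda>j s'. inp s' = inp s"]) (use For in auto)
  then show ?case by simp
qed auto

definition bounded_store :: "nat \<Rightarrow> store \<Rightarrow> bool" where
  "bounded_store B s \<longleftrightarrow>
    (\<forall>x. sc s x \<le> B) \<and> (\<forall>a j. ar s a j \<le> B) \<and> (\<forall>v \<in> set (inp s). v \<le> B)"

lemma bounded_store_set_var:
  "bounded_store B s \<Longrightarrow> v \<le> B \<Longrightarrow> bounded_store B (set_var x v s)"
  by (simp add: bounded_store_def)

lemma exec_bounded:
  "bounded_store B s \<Longrightarrow> max_const c \<le> B \<Longrightarrow> bounded_store B (exec c s)"
proof (induction c arbitrary: s)
  case (For y c)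
  have *: "sc s Size \<le> B" using For.prems by (simp add: bounded_store_def)
  have "bounded_store B (fold (\<lambda>j s. exec c (set_var y j s)) [0..<sc s Size] s)"
  proof (rule fold_invariant_upt[where I = "\<lambda>j. bounded_store B"])
    fix j s'
    assume "j < sc s Size" "bounded_store B s'"
    then show "bounded_store B (exec c (set_var y j s'))"
      using For * by (intro For.IH bounded_store_set_var) auto
  qed (rule For.prems)
  then show ?case using * by (simp add: bounded_store_set_var)
next
  case (Inc x)
  have "sc s x \<le> B" "sc s Size \<le> B" using Inc by (auto simp: bounded_store_def)
  then show ?case using Inc by (simp add: bounded_store_set_var)
next
  case (Dec x)
  have "sc s x \<le> B" using Dec by (auto simp: bounded_store_def)
  then show ?case using Dec by (simp add: bounded_store_set_var)
next
  case (Input x)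
  then show ?case by (cases "inp s") (auto simp: bounded_store_def)
next
  case (Seq c1 c2)
  then show ?case by simp
next
  case (IfLess x y c1 c2)
  then show ?case by simp
qed (simp_all add: bounded_store_def)

text \<open>
  Scalars live at addresses below \<open>30\<close>, the addresses \<open>30\<close> and \<open>31\<close> are scratch registers, and
  the arrays are interleaved from address \<open>32\<close> on.
\<close>

primrec var_addr :: "var \<Rightarrow> nat" where
  "var_addr Out = 0"
| "var_addr Size = 1"
| "var_addr Zero = 2"
| "var_addr Fail = 3"
| "var_addr Cur = 4"
| "var_addr Next = 5"
| "var_addr PosP = 6"
| "var_addr PosQ = 7"
| "var_addr Scan = 8"
| "var_addr Round = 9"
| "var_addr Val = 10"
| "var_addr State = 11"
| "var_addr Lab = 12"
| "var_addr Adj = 13"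
| "var_addr Mark = 14"
| "var_addr Found = 15"
| "var_addr Edge = 16"
| "var_addr Bad = 17"
| "var_addr Count = 18"
| "var_addr Const_Tmp = 19"

primrec arr_offset :: "arr \<Rightarrow> nat" where
  "arr_offset Row = 0"
| "arr_offset Vertex = 1"
| "arr_offset Adjacent = 2"
| "arr_offset Label = 3"
| "arr_offset Marking = 4"
| "arr_offset Degree = 5"
| "arr_offset Removed = 6"
| "arr_offset New_Vertex = 7"
| "arr_offset New_Label = 8"

definition arr_addr :: "arr \<Rightarrow> nat \<Rightarrow> nat" where
  "arr_addr a j = 32 + arr_offset a + 9 * j"

lemma var_addr_less: "var_addr x < 30"
  by (cases x) simp_all

lemma var_addr_eq_iff [simp]: "var_addr x = var_addr y \<longleftrightarrow> x = y"
  by (cases x; cases y) simp_all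

lemma arr_offset_less: "arr_offset a < 9"
  by (cases a) simp_all

lemma arr_offset_eq_iff [simp]: "arr_offset a = arr_offset b \<longleftrightarrow> a = b"
  by (cases a; cases b) simp_all

lemma arr_addr_eq_iff [simp]: "arr_addr a i = arr_addr b j \<longleftrightarrow> a = b \<and> i = j"
proof
  assume "arr_addr a i = arr_addr b j"
  then have "arr_offset a + 9 * i = arr_offset b + 9 * j"
    by (simp add: arr_addr_def)
  then have "arr_offset a = arr_offset b" "i = j"
    using arr_offset_less[of a] arr_offset_less[of b] by presburger+
  then show "a = b \<and> i = j" by simp
qed simp

lemma addr_neq [simp]:
  "var_addr x \<noteq> 30" "var_addr x \<noteq> 31" "arr_addr a i \<noteq> 30" "arr_addr a i \<noteq> 31"
  "var_addr x \<noteq> arr_addr a i" "arr_addr a i \<noteq> var_addr x"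
  using var_addr_less[of x] by (auto simp: arr_addr_def)

declare var_addr.simps [simp del] arr_offset.simps [simp del]

definition addr_code :: "arr \<Rightarrow> var \<Rightarrow> ram_instr list" where
  "addr_code a y = Set_Const 30 (32 + arr_offset a) # replicate 9 (Set_Add 30 30 (var_addr y))"

primrec code_length :: "com \<Rightarrow> nat" where
  "code_length SKIP = 0"
| "code_length (Const x c) = 1"
| "code_length (Copy x y) = 2"
| "code_length (Inc x) = 5"
| "code_length (Dec x) = 2"
| "code_length (Get x a y) = 11"
| "code_length (Put a y x) = 11"
| "code_length (Input x) = 1"
| "code_length (c1 ;; c2) = code_length c1 + code_length c2"
| "code_length (IfLess x y c1 c2) = code_length c1 + code_length c2 + 4"
| "code_length (For x c) = code_length c + 8"

primrec compile :: "com \<Rightarrow> nat \<Rightarrow> ram_instr list" where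
  "compile SKIP k = []"
| "compile (Const x c) k = [Set_Const (var_addr x) c]"
| "compile (Copy x y) k = [Set_Const 30 0, Set_Add (var_addr x) (var_addr y) 30]"
| "compile (Inc x) k =
    [Set_Const 31 1, Set_Sub 30 (var_addr Size) (var_addr x), Set_Sub 30 31 30, Set_Sub 30 31 30,
     Set_Add (var_addr x) (var_addr x) 30]"
| "compile (Dec x) k = [Set_Const 30 1, Set_Sub (var_addr x) (var_addr x) 30]"
| "compile (Get x a y) k = addr_code a y @ [Load (var_addr x) 30]"
| "compile (Put a y x) k = addr_code a y @ [Store 30 (var_addr x)]"
| "compile (Input x) k = [Read (var_addr x)]"
| "compile (c1 ;; c2) k = compile c1 k @ compile c2 (k + code_length c1)"
| "compile (IfLess x y c1 c2) k =
    [Set_Sub 30 (var_addr y) (var_addr x), Jump_Pos 30 (k + code_length c2 + 4)] @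
    compile c2 (k + 2) @
    [Set_Const 30 1, Jump_Pos 30 (k + code_length c1 + code_length c2 + 4)] @
    compile c1 (k + code_length c2 + 4)"
| "compile (For x c) k =
    [Set_Const (var_addr x) 0, Set_Sub 30 (var_addr Size) (var_addr x), Jump_Pos 30 (k + 5),
     Set_Const 30 1, Jump_Pos 30 (k + code_length c + 8)] @
    compile c (k + 5) @
    [Set_Const 30 1, Set_Add (var_addr x) (var_addr x) 30, Jump_Pos 30 (k + 1)]"

lemma length_compile [simp]: "length (compile c k) = code_length c"
  by (induction c arbitrary: k) (auto simp: addr_code_def)

definition code_at :: "ram_program \<Rightarrow> nat \<Rightarrow> ram_instr list \<Rightarrow> bool" where
  "code_at prog k is \<longleftrightarrow> k + length is \<le> length prog \<and> (\<forall>i < length is. prog ! (k + i) = is ! i)"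

lemma code_at_Nil [simp]: "code_at prog k [] \<longleftrightarrow> k \<le> length prog"
  by (simp add: code_at_def)

lemma code_at_Cons [simp]:
  "code_at prog k (i # is) \<longleftrightarrow> k < length prog \<and> prog ! k = i \<and> code_at prog (Suc k) is"
  unfolding code_at_def length_Cons All_less_Suc2 by auto

lemma code_at_append [simp]:
  "code_at prog k (is @ js) \<longleftrightarrow> code_at prog k is \<and> code_at prog (k + length is) js"
proof (induction "is" arbitrary: k)
  case Nil
  then show ?case by (auto simp: code_at_def)
qed simp

definition reach :: "ram_program \<Rightarrow> nat \<Rightarrow> nat \<Rightarrow> ram_config \<Rightarrow> ram_config \<Rightarrow> bool" where
  "reach prog W t s s' \<longleftrightarrow> (ram_step prog ^^ t) s = s' \<and>
    (\<forall>u \<le> t. \<forall>a. registers ((ram_step prog ^^ u) s) a \<le> W)"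

lemma reach_refl:
  assumes "\<And>a. R a \<le> W" "k = k'" "xs = xs'" "\<And>a. R a = R' a"
  shows "reach prog W 0 (k, xs, R) (k', xs', R')"
proof -
  have "R = R'" using assms(4) by (rule ext)
  then show ?thesis using assms by (simp add: reach_def)
qed

lemma reach_trans:
  assumes "reach prog W t s s'" "reach prog W t' s' s''"
  shows "reach prog W (t + t') s s''"
proof -
  have shift: "(ram_step prog ^^ (t + v)) s = (ram_step prog ^^ v) s'" for v
    using assms(1) by (subst add.commute) (simp add: funpow_add reach_def)
  have "registers ((ram_step prog ^^ u) s) a \<le> W" if "u \<le> t + t'" for u a
  proof (cases "u \<le> t")
    case True
    then show ?thesis using assms by (simp add: reach_def)
  next
    case False
    then show ?thesis
      using assms(2) shift[of "u - t"] that by (simp add: reach_def)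
  qed
  then show ?thesis using assms(2) shift[of t'] by (simp add: reach_def)
qed

lemma reach_step:
  assumes "k < length prog" "\<And>a. R a \<le> W" "reach prog W t (exec_instr (prog ! k) (k, xs, R)) s'"
  shows "reach prog W (Suc t) (k, xs, R) s'"
proof -
  have "ram_step prog (k, xs, R) = exec_instr (prog ! k) (k, xs, R)"
    using assms(1) by (simp add: ram_step_def)
  then have "reach prog W 1 (k, xs, R) (exec_instr (prog ! k) (k, xs, R))"
    using assms(2,3) by (auto simp: reach_def le_Suc_eq)
  from reach_trans[OF this assms(3)] show ?thesis by simp
qed

lemma reach_step_numeral:
  assumes "k < length prog" "\<And>a. R a \<le> W"
    and "reach prog W (pred_numeral v) (exec_instr (prog ! k) (k, xs, R)) s'"
  shows "reach prog W (numeral v) (k, xs, R) s'"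
  using reach_step[OF assms] by (simp add: numeral_eq_Suc)

definition store_rel :: "nat \<Rightarrow> store \<Rightarrow> (nat \<Rightarrow> nat) \<Rightarrow> bool" where
  "store_rel W s R \<longleftrightarrow> (\<forall>x. R (var_addr x) = sc s x) \<and> (\<forall>a j. R (arr_addr a j) = ar s a j) \<and>
    (\<forall>r. R r \<le> W)"

lemma store_rel_scratch [simp]:
  "store_rel W s R \<Longrightarrow> v \<le> W \<Longrightarrow> store_rel W s (R(30 := v))"
  "store_rel W s R \<Longrightarrow> v \<le> W \<Longrightarrow> store_rel W s (R(31 := v))"
  by (auto simp: store_rel_def)

lemma store_rel_set_var [simp]:
  "store_rel W s R \<Longrightarrow> v \<le> W \<Longrightarrow> store_rel W (set_var x v s) (R(var_addr x := v))"
  by (auto simp: store_rel_def)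

lemma store_rel_put [simp]:
  "store_rel W s R \<Longrightarrow> v \<le> W \<Longrightarrow>
    store_rel W (s\<lparr>ar := (ar s)(a := (ar s a)(i := v))\<rparr>) (R(arr_addr a i := v))"
  by (auto simp: store_rel_def)

lemma reach_addr:
  assumes "code_at prog k (replicate m (Set_Add 30 30 (var_addr y)))" "\<And>r. R r \<le> W"
    and "R 30 + m * R (var_addr y) \<le> W"
  shows "reach prog W m (k, xs, R) (k + m, xs, R(30 := R 30 + m * R (var_addr y)))"
  using assms
proof (induction m arbitrary: k R)
  case 0
  then show ?case by (simp add: reach_refl)
next
  case (Suc m)
  let ?R = "R(30 := R 30 + R (var_addr y))"
  have "reach prog W m (Suc k, xs, ?R) (Suc k + m, xs, ?R(30 := ?R 30 + m * ?R (var_addr y)))"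
    using Suc.prems by (intro Suc.IH) (auto simp: algebra_simps)
  moreover have "?R(30 := ?R 30 + m * ?R (var_addr y)) = R(30 := R 30 + Suc m * R (var_addr y))"
    by (auto simp: algebra_simps)
  ultimately have "reach prog W m (exec_instr (prog ! k) (k, xs, R))
      (k + Suc m, xs, R(30 := R 30 + Suc m * R (var_addr y)))"
    using Suc.prems(1) by (metis add_Suc_shift code_at_Cons exec_instr.simps(2) replicate_Suc)
  then show ?case
    by (rule reach_step[rotated 2]) (use Suc.prems in simp_all)
qed

lemma reach_addr_code:
  assumes "code_at prog k (addr_code a y)" "store_rel W s R" "41 + 9 * sc s y \<le> W"
  shows "reach prog W 10 (k, xs, R) (k + 10, xs, R(30 := arr_addr a (sc s y)))"
proof -
  have R: "R r \<le> W" for r using assms by (simp add: store_rel_def)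
  have y: "R (var_addr y) = sc s y" using assms by (simp add: store_rel_def)
  let ?R = "R(30 := 32 + arr_offset a)"
  have "reach prog W 9 (Suc k, xs, ?R) (Suc k + 9, xs, ?R(30 := ?R 30 + 9 * ?R (var_addr y)))"
    using assms R y arr_offset_less[of a] unfolding addr_code_def
    by (intro reach_addr) auto
  then have "reach prog W (Suc 9) (k, xs, R) (k + 10, xs, R(30 := arr_addr a (sc s y)))"
    using assms R y by (intro reach_step) (auto simp: addr_code_def arr_addr_def add.commute[of k])
  then show ?thesis by simp
qed

primrec run_time :: "com \<Rightarrow> nat \<Rightarrow> nat" where
  "run_time SKIP n = 0"
| "run_time (Const x c) n = 1"
| "run_time (Copy x y) n = 2"
| "run_time (Inc x) n = 5"
| "run_time (Dec x) n = 2"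
| "run_time (Get x a y) n = 11"
| "run_time (Put a y x) n = 11"
| "run_time (Input x) n = 1"
| "run_time (c1 ;; c2) n = run_time c1 n + run_time c2 n"
| "run_time (IfLess x y c1 c2) n = run_time c1 n + run_time c2 n + 4"
| "run_time (For x c) n = n * (run_time c n + 5) + 5"

lemma run_time_bound: "\<exists>C. \<forall>n. run_time c n \<le> C * (n + 1) ^ loop_depth c"
proof (induction c)
  case (Seq c1 c2)
  then obtain C1 C2 where C: "\<And>n. run_time c1 n \<le> C1 * (n + 1) ^ loop_depth c1"
    "\<And>n. run_time c2 n \<le> C2 * (n + 1) ^ loop_depth c2" by blast
  have "run_time (c1 ;; c2) n \<le> (C1 + C2) * (n + 1) ^ loop_depth (c1 ;; c2)" for n
  proof -
    have "(n + 1) ^ loop_depth c1 \<le> (n + 1) ^ loop_depth (c1 ;; c2)"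
      "(n + 1) ^ loop_depth c2 \<le> (n + 1) ^ loop_depth (c1 ;; c2)"
      by (rule power_increasing; simp)+
    then have "C1 * (n + 1) ^ loop_depth c1 \<le> C1 * (n + 1) ^ loop_depth (c1 ;; c2)"
      "C2 * (n + 1) ^ loop_depth c2 \<le> C2 * (n + 1) ^ loop_depth (c1 ;; c2)"
      by (blast intro: mult_le_mono2)+
    with C[of n] show ?thesis unfolding add_mult_distrib run_time.simps by linarith
  qed
  then show ?case by blast
next
  case (IfLess x y c1 c2)
  then obtain C1 C2 where C: "\<And>n. run_time c1 n \<le> C1 * (n + 1) ^ loop_depth c1"
    "\<And>n. run_time c2 n \<le> C2 * (n + 1) ^ loop_depth c2" by blast
  let ?d = "loop_depth (IfLess x y c1 c2)"
  have "run_time (IfLess x y c1 c2) n \<le> (C1 + C2 + 4) * (n + 1) ^ ?d" for n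
  proof -
    have "(n + 1) ^ loop_depth c1 \<le> (n + 1) ^ ?d" "(n + 1) ^ loop_depth c2 \<le> (n + 1) ^ ?d"
      by (rule power_increasing; simp)+
    then have "C1 * (n + 1) ^ loop_depth c1 \<le> C1 * (n + 1) ^ ?d"
      "C2 * (n + 1) ^ loop_depth c2 \<le> C2 * (n + 1) ^ ?d"
      by (blast intro: mult_le_mono2)+
    moreover have "4 \<le> 4 * (n + 1) ^ ?d" by simp
    ultimately show ?thesis using C[of n] unfolding add_mult_distrib run_time.simps by linarith
  qed
  then show ?case by blast
next
  case (For x c)
  then obtain C where C: "\<And>n. run_time c n \<le> C * (n + 1) ^ loop_depth c" by blast
  have "run_time (For x c) n \<le> (C + 5) * (n + 1) ^ loop_depth (For x c)" for n
  proof -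
    let ?p = "(n + 1) ^ loop_depth c"
    have "1 \<le> ?p" by simp
    have "n * (run_time c n + 5) + 5 \<le> n * (C * ?p + 5 * ?p) + 5 * ?p"
      using C[of n] \<open>1 \<le> ?p\<close> by (intro add_mono mult_le_mono2) auto
    also have "\<dots> \<le> (C + 5) * ((n + 1) * ?p)" by (simp add: algebra_simps)
    finally show ?thesis by simp
  qed
  then show ?case by blast
qed (auto intro: exI[of _ 11])

definition simulated :: "ram_program \<Rightarrow> nat \<Rightarrow> nat \<Rightarrow> com \<Rightarrow> bool" where
  "simulated prog W B c \<longleftrightarrow> (\<forall>k s R. code_at prog k (compile c k) \<longrightarrow> store_rel W s R \<longrightarrow>
    bounded_store B s \<longrightarrow>
    (\<exists>t R'. t \<le> run_time c (sc s Size) \<and> store_rel W (exec c s) R' \<and>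
      reach prog W t (k, inp s, R) (k + code_length c, inp (exec c s), R')))"

lemma simulatedI:
  assumes "\<And>k s R. code_at prog k (compile c k) \<Longrightarrow> store_rel W s R \<Longrightarrow> bounded_store B s \<Longrightarrow>
    \<exists>t R'. t \<le> run_time c (sc s Size) \<and> store_rel W (exec c s) R' \<and>
      reach prog W t (k, inp s, R) (k + code_length c, inp (exec c s), R')"
  shows "simulated prog W B c"
  using assms unfolding simulated_def by blast

lemma simulatedD:
  assumes "simulated prog W B c" "code_at prog k (compile c k)" "store_rel W s R" "bounded_store B s"
  obtains t R' where "t \<le> run_time c (sc s Size)" "store_rel W (exec c s) R'"
    "reach prog W t (k, inp s, R) (k + code_length c, inp (exec c s), R')"
  using assms unfolding simulated_def by blast

lemma simulated_Const:
  assumes W: "41 + 9 * B \<le> W" "c \<le> B"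
  shows "simulated prog W B (Const x c)"
proof (rule simulatedI)
  fix k s R
  assume code: "code_at prog k (compile (Const x c) k)" and rel: "store_rel W s R"
    and bounded: "bounded_store B s"
  have R: "R r \<le> W" "R (var_addr z) = sc s z" "R (arr_addr a' j) = ar s a' j" for r z a' j
    using rel by (auto simp: store_rel_def)
  have c: "c \<le> W" using assms by simp
  have "reach prog W 1 (k, inp s, R) (k + 1, inp s, R(var_addr x := c))"
    using code R c by (auto intro!: reach_refl reach_step reach_step_numeral)
  moreover have "store_rel W (set_var x c s) (R(var_addr x := c))"
    using rel c by (rule store_rel_set_var)
  ultimately show "\<exists>t R'. t \<le> run_time (Const x c) (sc s Size) \<and> store_rel W (exec (Const x c) s) R' \<and>
      reach prog W t (k, inp s, R) (k + code_length (Const x c), inp (exec (Const x c) s), R')"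
    by (intro exI[of _ 1]) auto
qed

lemma simulated_Copy:
  assumes W: "41 + 9 * B \<le> W"
  shows "simulated prog W B (Copy x y)"
proof (rule simulatedI)
  fix k s R
  assume code: "code_at prog k (compile (Copy x y) k)" and rel: "store_rel W s R"
    and bounded: "bounded_store B s"
  have R: "R r \<le> W" "R (var_addr z) = sc s z" "R (arr_addr a' j) = ar s a' j" for r z a' j
    using rel by (auto simp: store_rel_def)
  have B: "sc s z \<le> B" "ar s a' j \<le> B" for z a' j
    using bounded by (auto simp: bounded_store_def)
  have le_W: "sc s z \<le> W" "ar s a' j \<le> W" for z a' j
    using B(1)[of z] B(2)[of a' j] W by simp_all
  have "reach prog W 2 (k, inp s, R) (k + 2, inp s, R(30 := 0, var_addr x := sc s y))"
    using code R le_W by (auto intro!: reach_refl reach_step reach_step_numeral)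
  moreover have "store_rel W (set_var x (sc s y) s) (R(30 := 0, var_addr x := sc s y))"
    using rel le_W by (intro store_rel_set_var store_rel_scratch) auto
  ultimately show "\<exists>t R'. t \<le> run_time (Copy x y) (sc s Size) \<and> store_rel W (exec (Copy x y) s) R' \<and>
      reach prog W t (k, inp s, R) (k + code_length (Copy x y), inp (exec (Copy x y) s), R')"
    by (intro exI[of _ 2]) auto
qed

lemma simulated_Inc:
  assumes W: "41 + 9 * B \<le> W"
  shows "simulated prog W B (Inc x)"
proof (rule simulatedI)
  fix k s R
  assume code: "code_at prog k (compile (Inc x) k)" and rel: "store_rel W s R"
    and bounded: "bounded_store B s"
  have R: "R r \<le> W" "R (var_addr z) = sc s z" "R (arr_addr a' j) = ar s a' j" for r z a' j
    using rel by (auto simp: store_rel_def)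
  have B: "sc s z \<le> B" "ar s a' j \<le> B" for z a' j
    using bounded by (auto simp: bounded_store_def)
  define v where "v = (if sc s x < sc s Size then Suc (sc s x) else sc s x)"
  define m where "m = 1 - (sc s Size - sc s x)"
  have le: "v \<le> W" "m \<le> W" "1 - m \<le> W" "1 \<le> W" "sc s Size - sc s x \<le> W"
    using B(1)[of x] B(1)[of Size] W by (auto simp: v_def m_def)
  let ?R2 = "R(31 := 1, 30 := sc s Size - sc s x)"
  let ?R5 = "R(31 := 1, 30 := 1 - m, var_addr x := v)"
  have "reach prog W 2 (k, inp s, R) (k + 2, inp s, ?R2)"
    using code R(1,2) le by (auto intro!: reach_refl reach_step reach_step_numeral)
  moreover have "reach prog W 3 (k + 2, inp s, ?R2) (k + 5, inp s, ?R5)"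
  proof (cases "sc s x < sc s Size")
    case True
    then have "v = Suc (sc s x)" "m = 0" "Suc 0 - (sc s Size - sc s x) = 0"
      by (simp_all add: v_def m_def)
    then show ?thesis
      using code R(1,2) le by (auto intro!: reach_refl reach_step reach_step_numeral)
  next
    case False
    then have "v = sc s x" "m = 1" "sc s Size - sc s x = 0"
      by (simp_all add: v_def m_def)
    then show ?thesis
      using code R(1,2) le by (auto intro!: reach_refl reach_step reach_step_numeral)
  qed
  ultimately have "reach prog W (2 + 3) (k, inp s, R) (k + 5, inp s, ?R5)"
    by (rule reach_trans)
  moreover have "store_rel W (set_var x v s) ?R5"
    using rel le by (intro store_rel_set_var store_rel_scratch)
  ultimately show "\<exists>t R'. t \<le> run_time (Inc x) (sc s Size) \<and> store_rel W (exec (Inc x) s) R' \<and>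
      reach prog W t (k, inp s, R) (k + code_length (Inc x), inp (exec (Inc x) s), R')"
    by (intro exI[of _ 5]) (auto simp: v_def[symmetric])
qed

lemma simulated_Dec:
  assumes W: "41 + 9 * B \<le> W"
  shows "simulated prog W B (Dec x)"
proof (rule simulatedI)
  fix k s R
  assume code: "code_at prog k (compile (Dec x) k)" and rel: "store_rel W s R"
    and bounded: "bounded_store B s"
  have R: "R r \<le> W" "R (var_addr z) = sc s z" "R (arr_addr a' j) = ar s a' j" for r z a' j
    using rel by (auto simp: store_rel_def)
  have B: "sc s z \<le> B" "ar s a' j \<le> B" for z a' j
    using bounded by (auto simp: bounded_store_def)
  have le: "sc s x - 1 \<le> W" "1 \<le> W"
    using B(1)[of x] W by auto
  then have "reach prog W 2 (k, inp s, R) (k + 2, inp s, R(30 := 1, var_addr x := sc s x - 1))"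
    using code R by (auto intro!: reach_refl reach_step reach_step_numeral)
  moreover have "store_rel W (set_var x (sc s x - 1) s) (R(30 := 1, var_addr x := sc s x - 1))"
    using rel le by (intro store_rel_set_var store_rel_scratch)
  ultimately show "\<exists>t R'. t \<le> run_time (Dec x) (sc s Size) \<and> store_rel W (exec (Dec x) s) R' \<and>
      reach prog W t (k, inp s, R) (k + code_length (Dec x), inp (exec (Dec x) s), R')"
    by (intro exI[of _ 2]) auto
qed

lemma simulated_Get:
  assumes W: "41 + 9 * B \<le> W"
  shows "simulated prog W B (Get x a y)"
proof (rule simulatedI)
  fix k s R
  assume code: "code_at prog k (compile (Get x a y) k)" and rel: "store_rel W s R"
    and bounded: "bounded_store B s"
  have R: "R r \<le> W" "R (var_addr z) = sc s z" "R (arr_addr a' j) = ar s a' j" for r z a' j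
    using rel by (auto simp: store_rel_def)
  have B: "sc s z \<le> B" "ar s a' j \<le> B" for z a' j
    using bounded by (auto simp: bounded_store_def)
  have le_W: "sc s z \<le> W" "ar s a' j \<le> W" for z a' j
    using B(1)[of z] B(2)[of a' j] W by simp_all
  let ?R = "R(30 := arr_addr a (sc s y))"
  have addr: "arr_addr a (sc s y) \<le> W"
    using B(1)[of y] W arr_offset_less[of a] by (simp add: arr_addr_def)
  have instr: "k + 10 < length prog" "prog ! (k + 10) = Load (var_addr x) 30"
    using code by (auto simp: addr_code_def add.commute[of k])
  have "reach prog W 10 (k, inp s, R) (k + 10, inp s, ?R)"
    using code rel W B(1)[of y] by (intro reach_addr_code) auto
  moreover have "reach prog W 1 (k + 10, inp s, ?R) (k + 11, inp s, ?R(var_addr x := ar s a (sc s y)))"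
    using instr R addr le_W by (auto intro!: reach_refl reach_step reach_step_numeral)
  ultimately have "reach prog W (10 + 1) (k, inp s, R) (k + 11, inp s, ?R(var_addr x := ar s a (sc s y)))"
    by (rule reach_trans)
  moreover have "store_rel W (exec (Get x a y) s) (?R(var_addr x := ar s a (sc s y)))"
    using rel addr le_W by (auto simp del: fun_upd_apply)
  ultimately show "\<exists>t R'. t \<le> run_time (Get x a y) (sc s Size) \<and> store_rel W (exec (Get x a y) s) R' \<and>
      reach prog W t (k, inp s, R) (k + code_length (Get x a y), inp (exec (Get x a y) s), R')"
    by (intro exI[of _ 11]) auto
qed

lemma simulated_Put:
  assumes W: "41 + 9 * B \<le> W"
  shows "simulated prog W B (Put a y x)"
proof (rule simulatedI)
  fix k s R
  assume code: "code_at prog k (compile (Put a y x) k)" and rel: "store_rel W s R"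
    and bounded: "bounded_store B s"
  have R: "R r \<le> W" "R (var_addr z) = sc s z" "R (arr_addr a' j) = ar s a' j" for r z a' j
    using rel by (auto simp: store_rel_def)
  have B: "sc s z \<le> B" "ar s a' j \<le> B" for z a' j
    using bounded by (auto simp: bounded_store_def)
  have le_W: "sc s z \<le> W" "ar s a' j \<le> W" for z a' j
    using B(1)[of z] B(2)[of a' j] W by simp_all
  let ?R = "R(30 := arr_addr a (sc s y))"
  have addr: "arr_addr a (sc s y) \<le> W"
    using B(1)[of y] W arr_offset_less[of a] by (simp add: arr_addr_def)
  have instr: "k + 10 < length prog" "prog ! (k + 10) = Store 30 (var_addr x)"
    using code by (auto simp: addr_code_def add.commute[of k])
  have "reach prog W 10 (k, inp s, R) (k + 10, inp s, ?R)"
    using code rel W B(1)[of y] by (intro reach_addr_code) auto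
  moreover have "reach prog W 1 (k + 10, inp s, ?R) (k + 11, inp s, ?R(arr_addr a (sc s y) := sc s x))"
    using instr R addr le_W by (auto intro!: reach_refl reach_step reach_step_numeral)
  ultimately have "reach prog W (10 + 1) (k, inp s, R) (k + 11, inp s, ?R(arr_addr a (sc s y) := sc s x))"
    by (rule reach_trans)
  moreover have "store_rel W (exec (Put a y x) s) (?R(arr_addr a (sc s y) := sc s x))"
    using rel addr le_W by (auto simp del: fun_upd_apply)
  ultimately show "\<exists>t R'. t \<le> run_time (Put a y x) (sc s Size) \<and> store_rel W (exec (Put a y x) s) R' \<and>
      reach prog W t (k, inp s, R) (k + code_length (Put a y x), inp (exec (Put a y x) s), R')"
    by (intro exI[of _ 11]) auto
qed

lemma simulated_Input:
  assumes W: "41 + 9 * B \<le> W"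
  shows "simulated prog W B (Input x)"
proof (rule simulatedI)
  fix k s R
  assume code: "code_at prog k (compile (Input x) k)" and rel: "store_rel W s R"
    and bounded: "bounded_store B s"
  have R: "R r \<le> W" "R (var_addr z) = sc s z" "R (arr_addr a' j) = ar s a' j" for r z a' j
    using rel by (auto simp: store_rel_def)
  define v where "v = (case inp s of [] \<Rightarrow> 0 | v # vs \<Rightarrow> v)"
  have v: "v \<le> W"
    using bounded W by (auto simp: v_def bounded_store_def split: list.split)
  have "reach prog W 1 (k, inp s, R) (k + 1, inp (exec (Input x) s), R(var_addr x := v))"
    using code R v by (cases "inp s") (auto simp: v_def intro!: reach_refl reach_step)
  moreover have "store_rel W (exec (Input x) s) (R(var_addr x := v))"
    using rel v by (auto simp: v_def store_rel_def split: list.split)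
  ultimately show "\<exists>t R'. t \<le> run_time (Input x) (sc s Size) \<and> store_rel W (exec (Input x) s) R' \<and>
      reach prog W t (k, inp s, R) (k + code_length (Input x), inp (exec (Input x) s), R')"
    by (intro exI[of _ 1]) auto
qed

lemma simulated_Seq:
  assumes 1: "simulated prog W B c1" "wf_com c1" "max_const c1 \<le> B" and 2: "simulated prog W B c2"
  shows "simulated prog W B (c1 ;; c2)"
proof (rule simulatedI)
  fix k s R
  assume code: "code_at prog k (compile (c1 ;; c2) k)" and rel: "store_rel W s R"
    and bounded: "bounded_store B s"
  obtain t1 R1 where t1: "t1 \<le> run_time c1 (sc s Size)" "store_rel W (exec c1 s) R1"
    "reach prog W t1 (k, inp s, R) (k + code_length c1, inp (exec c1 s), R1)"
    using simulatedD[OF 1(1) _ rel bounded] code by auto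
  have "code_at prog (k + code_length c1) (compile c2 (k + code_length c1))"
    using code by simp
  from simulatedD[OF 2 this t1(2) exec_bounded[OF bounded 1(3)]]
  obtain t2 R2 where t2: "t2 \<le> run_time c2 (sc (exec c1 s) Size)"
    "store_rel W (exec c2 (exec c1 s)) R2"
    "reach prog W t2 (k + code_length c1, inp (exec c1 s), R1)
        (k + code_length c1 + code_length c2, inp (exec c2 (exec c1 s)), R2)" .
  have "sc (exec c1 s) Size = sc s Size"
    using 1(2) by (intro exec_var wf_com_Size)
  with t1 t2 reach_trans[OF t1(3) t2(3)]
  show "\<exists>t R'. t \<le> run_time (c1 ;; c2) (sc s Size) \<and> store_rel W (exec (c1 ;; c2) s) R' \<and>
      reach prog W t (k, inp s, R) (k + code_length (c1 ;; c2), inp (exec (c1 ;; c2) s), R')"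
    by (intro exI[of _ "t1 + t2"] exI[of _ R2]) (simp add: add.assoc)
qed

lemma simulated_IfLess:
  assumes W: "41 + 9 * B \<le> W"
    and 1: "simulated prog W B c1" and 2: "simulated prog W B c2"
  shows "simulated prog W B (IfLess x y c1 c2)"
proof (rule simulatedI)
  fix k s R
  assume code: "code_at prog k (compile (IfLess x y c1 c2) k)" and rel: "store_rel W s R"
    and bounded: "bounded_store B s"
  have R: "R r \<le> W" "R (var_addr z) = sc s z" "R (arr_addr a' j) = ar s a' j" for r z a' j
    using rel by (auto simp: store_rel_def)
  have B: "sc s z \<le> B" "ar s a' j \<le> B" for z a' j
    using bounded by (auto simp: bounded_store_def)
  have instr: "k + 1 < length prog" "prog ! k = Set_Sub 30 (var_addr y) (var_addr x)"
    "prog ! (k + 1) = Jump_Pos 30 (k + code_length c2 + 4)"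
    "code_at prog (k + 2) (compile c2 (k + 2))"
    "k + 2 + code_length c2 + 1 < length prog" "prog ! (k + 2 + code_length c2) = Set_Const 30 1"
    "prog ! (k + 2 + code_length c2 + 1) = Jump_Pos 30 (k + code_length c1 + code_length c2 + 4)"
    "code_at prog (k + code_length c2 + 4) (compile c1 (k + code_length c2 + 4))"
    using code by (simp_all add: eval_nat_numeral)
  let ?R = "R(30 := sc s y - sc s x)"
  have le: "sc s y - sc s x \<le> W" "1 \<le> W" using B(1)[of y] W by auto
  have rel': "store_rel W s ?R" using rel le(1) by (rule store_rel_scratch)
  have test: "reach prog W 2 (k, inp s, R)
      (if sc s x < sc s y then k + code_length c2 + 4 else k + 2, inp s, ?R)"
    using instr(1-3) R le by (auto intro!: reach_refl reach_step reach_step_numeral)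
  show "\<exists>t R'. t \<le> run_time (IfLess x y c1 c2) (sc s Size) \<and> store_rel W (exec (IfLess x y c1 c2) s) R' \<and>
      reach prog W t (k, inp s, R) (k + code_length (IfLess x y c1 c2), inp (exec (IfLess x y c1 c2) s), R')"
  proof (cases "sc s x < sc s y")
    case True
    from simulatedD[OF 1 instr(8) rel' bounded]
    obtain t R' where t: "t \<le> run_time c1 (sc s Size)" "store_rel W (exec c1 s) R'"
      "reach prog W t (k + code_length c2 + 4, inp s, ?R)
          (k + code_length c2 + 4 + code_length c1, inp (exec c1 s), R')" .
    have "reach prog W (2 + t) (k, inp s, R)
        (k + code_length c2 + 4 + code_length c1, inp (exec c1 s), R')"
      using test True by (intro reach_trans[OF _ t(3)]) simp
    then show ?thesis
      using True t by (intro exI[of _ "2 + t"] exI[of _ R']) (simp add: add_ac)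
  next
    case False
    from simulatedD[OF 2 instr(4) rel' bounded]
    obtain t R' where t: "t \<le> run_time c2 (sc s Size)" "store_rel W (exec c2 s) R'"
      "reach prog W t (k + 2, inp s, ?R) (k + 2 + code_length c2, inp (exec c2 s), R')" .
    have 1: "reach prog W (2 + t) (k, inp s, R) (k + 2 + code_length c2, inp (exec c2 s), R')"
      using test False by (intro reach_trans[OF _ t(3)]) simp
    have R': "R' r \<le> W" for r using t(2) by (simp add: store_rel_def)
    have "reach prog W 2 (k + 2 + code_length c2, inp (exec c2 s), R')
        (k + code_length c1 + code_length c2 + 4, inp (exec c2 s), R'(30 := 1))"
      using instr(5-7) R' le by (auto intro!: reach_refl reach_step reach_step_numeral)
    from reach_trans[OF 1 this] show ?thesis
      using t False store_rel_scratch(1)[OF t(2) le(2)]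
      by (intro exI[of _ "2 + t + 2"] exI[of _ "R'(30 := 1)"]) (simp add: add_ac)
  qed
qed

lemma simulated_For:
  assumes W: "41 + 9 * B \<le> W"
    and c: "simulated prog W B c" "wf_com (For x c)" "max_const c \<le> B"
  shows "simulated prog W B (For x c)"
proof (rule simulatedI)
  fix k s R
  assume code: "code_at prog k (compile (For x c) k)" and rel: "store_rel W s R"
    and bounded: "bounded_store B s"
  have R: "R r \<le> W" "R (var_addr z) = sc s z" "R (arr_addr a' j) = ar s a' j" for r z a' j
    using rel by (auto simp: store_rel_def)
  have B: "sc s z \<le> B" "ar s a' j \<le> B" for z a' j
    using bounded by (auto simp: bounded_store_def)
  have instr: "k + 4 < length prog" "prog ! k = Set_Const (var_addr x) 0"
    "prog ! (k + 1) = Set_Sub 30 (var_addr Size) (var_addr x)" "prog ! (k + 2) = Jump_Pos 30 (k + 5)"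
    "prog ! Suc (Suc (Suc k)) = Set_Const 30 1"
    "prog ! Suc (Suc (Suc (Suc k))) = Jump_Pos 30 (k + code_length c + 8)"
    "code_at prog (k + 5) (compile c (k + 5))" "k + 5 + code_length c + 2 < length prog"
    "prog ! (k + 5 + code_length c) = Set_Const 30 1"
    "prog ! (k + 5 + code_length c + 1) = Set_Add (var_addr x) (var_addr x) 30"
    "prog ! (k + 5 + code_length c + 2) = Jump_Pos 30 (k + 1)"
    using code by (simp_all add: eval_nat_numeral)
  have x: "x \<noteq> Size" "x \<notin> mod_vars c" "Size \<notin> mod_vars c"
    using c(2) wf_com_Size[of c] by auto
  define n where "n = sc s Size"
  define F where "F j = fold (\<lambda>j s. exec c (set_var x j s)) [0..<j] s" for j
  have F_Suc: "F (Suc j) = exec c (set_var x j (F j))" for j by (simp add: F_def)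
  have n: "n \<le> B" "n \<le> W" using B(1)[of Size] W by (auto simp: n_def)
  have F_Size: "sc (F j) Size = n" for j
    unfolding F_def n_def
    by (rule fold_invariant_upt[where I = "\<lambda>j s'. sc s' Size = sc s Size"])
      (use x in \<open>auto simp: exec_var\<close>)
  have F_bounded: "bounded_store B (F j)" if "j \<le> n" for j
    unfolding F_def
    by (rule fold_invariant_upt[where I = "\<lambda>j. bounded_store B"])
      (use bounded c(3) that n in \<open>auto intro!: exec_bounded bounded_store_set_var\<close>)
  have body: "\<exists>t R'. t \<le> run_time c n + 5 \<and> store_rel W (set_var x (Suc j) (F (Suc j))) R' \<and>
      reach prog W t (k + 1, inp (F j), R) (k + 1, inp (F (Suc j)), R')"
    if j: "j < n" and rel: "store_rel W (set_var x j (F j)) R" for j R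
  proof -
    let ?s = "set_var x j (F j)"
    have R: "R r \<le> W" "R (var_addr z) = sc ?s z" for r z using rel by (auto simp: store_rel_def)
    have Rx: "R (var_addr Size) = n" "R (var_addr x) = j"
      using R(2)[of Size] R(2)[of x] F_Size x by auto
    have le: "n - j \<le> W" "1 \<le> W" "Suc j \<le> W" using n W j by auto
    have 1: "reach prog W 2 (k + 1, inp ?s, R) (k + 5, inp ?s, R(30 := n - j))"
      using instr R(1) Rx j le by (auto intro!: reach_refl reach_step reach_step_numeral)
    have rel': "store_rel W ?s (R(30 := n - j))"
      using rel le(1) by (rule store_rel_scratch)
    have "bounded_store B ?s"
      using j n by (intro bounded_store_set_var F_bounded) auto
    from simulatedD[OF c(1) instr(7) rel' this]
    obtain t R' where t: "t \<le> run_time c (sc ?s Size)" "store_rel W (exec c ?s) R'"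
      "reach prog W t (k + 5, inp ?s, R(30 := n - j)) (k + 5 + code_length c, inp (exec c ?s), R')" .
    have 2: "reach prog W (2 + t) (k + 1, inp (F j), R)
        (k + 5 + code_length c, inp (F (Suc j)), R')"
      using reach_trans[OF 1 t(3)] by (simp add: F_Suc)
    have R': "R' r \<le> W" "R' (var_addr x) = j" for r
      using t(2) x by (auto simp: store_rel_def exec_var)
    have "reach prog W 3 (k + 5 + code_length c, inp (F (Suc j)), R')
        (k + 1, inp (F (Suc j)), R'(30 := 1, var_addr x := Suc j))"
      using instr R' le by (auto intro!: reach_refl reach_step reach_step_numeral)
    from reach_trans[OF 2 this] show ?thesis
      using t(1) F_Size x store_rel_set_var[OF store_rel_scratch(1)[OF t(2) le(2)] le(3)]
      by (intro exI[of _ "2 + t + 3"] exI[of _ "R'(30 := 1, var_addr x := Suc j)"])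
        (simp add: F_Suc)
  qed
  have loop: "\<exists>t R'. t \<le> j * (run_time c n + 5) + 1 \<and>
      store_rel W (set_var x j (F j)) R' \<and>
      reach prog W t (k, inp s, R) (k + 1, inp (F j), R')" if "j \<le> n" for j
    using that
  proof (induction j)
    case 0
    have "reach prog W 1 (k, inp s, R) (k + 1, inp (F 0), R(var_addr x := 0))"
      using instr R by (auto intro!: reach_refl reach_step simp: F_def)
    then show ?case
      using store_rel_set_var[OF rel, of 0 x]
      by (intro exI[of _ 1] exI[of _ "R(var_addr x := 0)"])
        (simp add: F_def del: fun_upd_apply)
  next
    case (Suc j)
    then obtain t R' where t: "t \<le> j * (run_time c n + 5) + 1" "store_rel W (set_var x j (F j)) R'"
      "reach prog W t (k, inp s, R) (k + 1, inp (F j), R')" using Suc_leD by blast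
    from Suc.prems have "j < n" by simp
    from body[OF this t(2)] obtain t' R'' where t': "t' \<le> run_time c n + 5"
      "store_rel W (set_var x (Suc j) (F (Suc j))) R''"
      "reach prog W t' (k + 1, inp (F j), R') (k + 1, inp (F (Suc j)), R'')" by blast
    from t(1) t'(1) have "t + t' \<le> Suc j * (run_time c n + 5) + 1" by simp
    with reach_trans[OF t(3) t'(3)] t'(2) show ?case by blast
  qed
  from loop[OF order_refl] obtain t R' where t: "t \<le> n * (run_time c n + 5) + 1"
    "store_rel W (set_var x n (F n)) R'" "reach prog W t (k, inp s, R) (k + 1, inp (F n), R')"
    by blast
  have R': "R' r \<le> W" "R' (var_addr z) = sc (set_var x n (F n)) z" for r z
    using t(2) by (auto simp: store_rel_def)
  have Rx: "R' (var_addr Size) = n" "R' (var_addr x) = n"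
    using R'(2)[of Size] R'(2)[of x] F_Size by auto
  have "1 \<le> W" using W by simp
  have "reach prog W 4 (k + 1, inp (F n), R') (k + code_length c + 8, inp (F n), R'(30 := 1))"
    using instr R'(1) Rx \<open>1 \<le> W\<close> by (auto intro!: reach_refl reach_step reach_step_numeral)
  from reach_trans[OF t(3) this]
  show "\<exists>t R'. t \<le> run_time (For x c) (sc s Size) \<and> store_rel W (exec (For x c) s) R' \<and>
      reach prog W t (k, inp s, R) (k + code_length (For x c), inp (exec (For x c) s), R')"
    using t(1) store_rel_scratch(1)[OF t(2) \<open>1 \<le> W\<close>]
    by (intro exI[of _ "t + 4"] exI[of _ "R'(30 := 1)"])
      (simp add: F_def n_def[symmetric] add_ac del: fun_upd_apply)
qed

theorem compile_correct:
  assumes "41 + 9 * B \<le> W"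
  shows "wf_com c \<Longrightarrow> max_const c \<le> B \<Longrightarrow> simulated prog W B c"
proof (induction c)
  case SKIP
  show ?case
    by (rule simulatedI) (auto simp: store_rel_def intro!: exI[of _ 0] reach_refl)
next
  case (Seq c1 c2)
  then show ?case using assms by (intro simulated_Seq) auto
next
  case (IfLess x y c1 c2)
  then show ?case using assms by (intro simulated_IfLess) auto
next
  case (For x c)
  then show ?case using assms by (intro simulated_For) auto
qed (use assms in \<open>simp_all add: simulated_Const simulated_Copy simulated_Inc simulated_Dec
    simulated_Get simulated_Put simulated_Input\<close>)

section \<open>Letter graphs\<close>

text \<open>
  These are the letter graphs of Petkovsek for a fixed decoder \<open>A\<close>; the letters are the numbers
  below \<open>D\<close>, and \<open>r\<close> is the rank of a vertex in the word.
\<close>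

definition represents ::
  "nat \<Rightarrow> (nat \<Rightarrow> nat \<Rightarrow> bool) \<Rightarrow> ('v \<Rightarrow> 'v \<Rightarrow> bool) \<Rightarrow> 'v set \<Rightarrow> ('v \<Rightarrow> nat) \<Rightarrow> ('v \<Rightarrow> nat) \<Rightarrow> bool"
  where
  "represents D A E V l r \<longleftrightarrow> inj_on r V \<and> (\<forall>v\<in>V. l v < D) \<and>
    (\<forall>u\<in>V. \<forall>v\<in>V. r u < r v \<longrightarrow> (E u v \<longleftrightarrow> A (l u) (l v)))"

definition letter_graph ::
  "nat \<Rightarrow> (nat \<Rightarrow> nat \<Rightarrow> bool) \<Rightarrow> ('v \<Rightarrow> 'v \<Rightarrow> bool) \<Rightarrow> 'v set \<Rightarrow> bool" where
  "letter_graph D A E V \<longleftrightarrow> (\<exists>l r. represents D A E V l r)"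

lemma represents_comp:
  assumes "represents D A E V l r" "inj_on f U" "f ` U \<subseteq> V"
    and "\<And>u v. u \<in> U \<Longrightarrow> v \<in> U \<Longrightarrow> u \<noteq> v \<Longrightarrow> E' u v = E (f u) (f v)"
  shows "represents D A E' U (l \<circ> f) (r \<circ> f)"
proof -
  have "inj_on (r \<circ> f) U"
    using assms(1-3) by (intro comp_inj_on) (auto simp: represents_def intro: inj_on_subset)
  moreover have "E' u v \<longleftrightarrow> A (l (f u)) (l (f v))" if "u \<in> U" "v \<in> U" "r (f u) < r (f v)" for u v
  proof -
    have "u \<noteq> v" using that by auto
    then show ?thesis using assms that unfolding represents_def by blast
  qed
  ultimately show ?thesis
    using assms(1,3) unfolding represents_def by (simp add: image_subset_iff)
qed

lemma represents_cong:
  assumes "\<And>u v. u \<in> V \<Longrightarrow> v \<in> V \<Longrightarrow> u \<noteq> v \<Longrightarrow> E u v = E' u v"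
  shows "represents D A E V l r \<longleftrightarrow> represents D A E' V l r"
  using represents_comp[of D A E V l r id V E'] represents_comp[of D A E' V l r id V E] assms by auto

lemma letter_graph_subset:
  assumes "letter_graph D A E V" "U \<subseteq> V"
  shows "letter_graph D A E U"
proof -
  from assms(1) obtain l r where "represents D A E V l r" by (auto simp: letter_graph_def)
  from represents_comp[OF this, of id U E] show ?thesis
    using assms(2) by (auto simp: letter_graph_def)
qed

lemma letter_graph_bij:
  assumes "bij_betw f U V" "\<And>u v. u \<in> U \<Longrightarrow> v \<in> U \<Longrightarrow> u \<noteq> v \<Longrightarrow> E' u v = E (f u) (f v)"
  shows "letter_graph D A E' U \<longleftrightarrow> letter_graph D A E V"
proof
  assume "letter_graph D A E V"
  then show "letter_graph D A E' U"
    using represents_comp[of D A E V _ _ f U E'] assms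
    unfolding letter_graph_def bij_betw_def by blast
next
  assume "letter_graph D A E' U"
  then obtain l r where lr: "represents D A E' U l r" by (auto simp: letter_graph_def)
  let ?g = "the_inv_into U f"
  have g: "bij_betw ?g V U" using assms(1) by (rule bij_betw_the_inv_into)
  have "represents D A E V (l \<circ> ?g) (r \<circ> ?g)"
  proof (rule represents_comp[OF lr])
    fix u v assume uv: "u \<in> V" "v \<in> V" "u \<noteq> v"
    have "?g u \<in> U" "?g v \<in> U" "?g u \<noteq> ?g v"
      using g uv unfolding bij_betw_def by (auto dest: inj_onD)
    moreover have "f (?g u) = u" "f (?g v) = v"
      using f_the_inv_into_f_bij_betw[OF assms(1)] uv by auto
    ultimately show "E u v = E' (?g u) (?g v)" using assms(2) by metis
  qed (use g in \<open>auto simp: bij_betw_def\<close>)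
  then show "letter_graph D A E V" by (auto simp: letter_graph_def)
qed

text \<open>
  The word \<open>lab\<close> of length \<open>i\<close> describes a graph on the positions \<open>0, \<dots>, i - 1\<close>; the position
  \<open>i\<close> stands for a further vertex, whose neighbours are given by \<open>adj\<close>.
\<close>

definition pos_edge ::
  "(nat \<Rightarrow> nat \<Rightarrow> bool) \<Rightarrow> nat \<Rightarrow> (nat \<Rightarrow> nat) \<Rightarrow> (nat \<Rightarrow> nat) \<Rightarrow> nat \<Rightarrow> nat \<Rightarrow> bool" where
  "pos_edge A i lab adj p q \<longleftrightarrow>
    (if max p q < i then A (lab (min p q)) (lab (max p q)) else adj (min p q) = 1)"

text \<open>Marks that are not letters, such as \<open>D\<close>, leave the letter of a position open.\<close>

definition extendable ::
  "nat \<Rightarrow> (nat \<Rightarrow> nat \<Rightarrow> bool) \<Rightarrow> nat \<Rightarrow> (nat \<Rightarrow> nat) \<Rightarrow> (nat \<Rightarrow> nat) \<Rightarrow> (nat \<Rightarrow> nat) \<Rightarrow> bool" where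
  "extendable D A i lab adj mark \<longleftrightarrow> (\<exists>l r. represents D A (pos_edge A i lab adj) {..i} l r \<and>
    (\<forall>p\<le>i. mark p < D \<longrightarrow> l p = mark p))"

lemma extendable_cong:
  assumes "\<And>p. p < i \<Longrightarrow> lab p = lab' p" "\<And>p. p < i \<Longrightarrow> adj p = adj' p"
    and "\<And>p. p \<le> i \<Longrightarrow> mark p = mark' p"
  shows "extendable D A i lab adj mark \<longleftrightarrow> extendable D A i lab' adj' mark'"
proof -
  have E: "pos_edge A i lab adj p q \<longleftrightarrow> pos_edge A i lab' adj' p q" if "p \<le> i" "q \<le> i" "p \<noteq> q" for p q
    using assms(1,2) that by (auto simp: pos_edge_def min_def max_def)
  have "represents D A (pos_edge A i lab adj) {..i} l r \<longleftrightarrow>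
      represents D A (pos_edge A i lab' adj') {..i} l r" for l r
    by (rule represents_cong) (use E in auto)
  then show ?thesis using assms(3) by (auto simp: extendable_def)
qed

lemma extendable_mark:
  assumes "p \<le> i" "D \<le> mark p"
  shows "extendable D A i lab adj mark \<longleftrightarrow> (\<exists>a<D. extendable D A i lab adj (mark(p := a)))"
proof
  assume "extendable D A i lab adj mark"
  then obtain l r where lr: "represents D A (pos_edge A i lab adj) {..i} l r"
    "\<forall>p\<le>i. mark p < D \<longrightarrow> l p = mark p"
    by (auto simp: extendable_def)
  then have "l p < D" using assms by (simp add: represents_def)
  moreover have "extendable D A i lab adj (mark(p := l p))"
    unfolding extendable_def by (rule exI[of _ l], rule exI[of _ r]) (use lr in auto)
  ultimately show "\<exists>a<D. extendable D A i lab adj (mark(p := a))" by blast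
next
  assume "\<exists>a<D. extendable D A i lab adj (mark(p := a))"
  then obtain a l r where "represents D A (pos_edge A i lab adj) {..i} l r"
    "\<forall>q\<le>i. (mark(p := a)) q < D \<longrightarrow> l q = (mark(p := a)) q"
    by (auto simp: extendable_def)
  then show "extendable D A i lab adj mark"
    unfolding extendable_def using assms by (metis fun_upd_apply not_le)
qed

lemma extendable_unmarked:
  assumes "\<And>p. p \<le> i \<Longrightarrow> D \<le> mark p"
  shows "extendable D A i lab adj mark \<longleftrightarrow> letter_graph D A (pos_edge A i lab adj) {..i}"
  using assms by (fastforce simp: extendable_def letter_graph_def)

lemma extendable_marked:
  assumes "extendable D A i lab adj mark" "\<And>p. p \<le> i \<Longrightarrow> mark p < D"
  obtains r where "represents D A (pos_edge A i lab adj) {..i} mark r"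
proof -
  from assms obtain l r where lr: "represents D A (pos_edge A i lab adj) {..i} l r"
    "\<And>p. p \<le> i \<Longrightarrow> l p = mark p"
    by (auto simp: extendable_def)
  then have "represents D A (pos_edge A i lab adj) {..i} mark r"
    by (simp add: represents_def)
  then show thesis by (rule that)
qed

definition word_extendable ::
  "nat \<Rightarrow> (nat \<Rightarrow> nat \<Rightarrow> bool) \<Rightarrow> nat \<Rightarrow> (nat \<times> nat \<times> nat) list \<Rightarrow> bool" where
  "word_extendable D A x w \<longleftrightarrow> extendable D A (length w) (\<lambda>p. fst (w ! p)) (\<lambda>p. fst (snd (w ! p)))
    (\<lambda>p. if p < length w then snd (snd (w ! p)) else x)"

lemma subseq_embedding:
  assumes "subseq u w"
  obtains f where "strict_mono_on {..<length u} f" "\<And>p. p < length u \<Longrightarrow> f p < length w"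
    "\<And>p. p < length u \<Longrightarrow> u ! p = w ! f p"
  using assms
proof (induction arbitrary: thesis rule: list_emb.induct)
  case (list_emb_Nil ys)
  then show ?case by (auto simp: strict_mono_on_def)
next
  case (list_emb_Cons xs ys y)
  from list_emb_Cons.IH obtain f where f: "strict_mono_on {..<length xs} f"
    "\<And>p. p < length xs \<Longrightarrow> f p < length ys" "\<And>p. p < length xs \<Longrightarrow> xs ! p = ys ! f p" by blast
  show ?case
    by (rule list_emb_Cons.prems[of "Suc \<circ> f"]) (use f in \<open>auto simp: strict_mono_on_def\<close>)
next
  case (list_emb_Cons2 x y xs ys)
  from list_emb_Cons2.IH obtain f where f: "strict_mono_on {..<length xs} f"
    "\<And>p. p < length xs \<Longrightarrow> f p < length ys" "\<And>p. p < length xs \<Longrightarrow> xs ! p = ys ! f p" by blast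
  show ?case
    by (rule list_emb_Cons2.prems[of "case_nat 0 (Suc \<circ> f)"])
      (use f list_emb_Cons2.hyps in \<open>auto simp: strict_mono_on_def nth_Cons split: nat.split\<close>)
qed

lemma word_extendable_subseq:
  assumes "subseq u w" "word_extendable D A x w"
  shows "word_extendable D A x u"
proof -
  let ?m = "length u" and ?n = "length w"
  obtain f0 where f0: "strict_mono_on {..<?m} f0" "\<And>p. p < ?m \<Longrightarrow> f0 p < ?n"
    "\<And>p. p < ?m \<Longrightarrow> u ! p = w ! f0 p"
    using subseq_embedding[OF assms(1)] by blast
  define f where "f p = (if p < ?m then f0 p else ?n)" for p
  have mono: "f p < f q" if "p < q" "q \<le> ?m" for p q
    using f0 that by (auto simp: f_def strict_mono_on_def)
  have f_le: "f p \<le> ?n" "f p < ?n \<longleftrightarrow> p < ?m" for p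
    using f0(2) by (auto simp: f_def less_imp_le)
  have minmax: "min (f p) (f q) = f (min p q)" "max (f p) (f q) = f (max p q)"
    if "p \<le> ?m" "q \<le> ?m" for p q
    using mono[of p q] mono[of q p] that
    by (cases p q rule: linorder_cases; auto simp: min_def max_def)+
  let ?E = "\<lambda>w. pos_edge A (length w) (\<lambda>p. fst (w ! p)) (\<lambda>p. fst (snd (w ! p)))"
  obtain l r where lr: "represents D A (?E w) {..?n} l r"
    "\<And>p. p \<le> ?n \<Longrightarrow> (if p < ?n then snd (snd (w ! p)) else x) < D \<Longrightarrow>
      l p = (if p < ?n then snd (snd (w ! p)) else x)"
    using assms(2) unfolding word_extendable_def extendable_def by auto
  have "represents D A (?E u) {..?m} (l \<circ> f) (r \<circ> f)"
  proof (rule represents_comp[OF lr(1)])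
    show "inj_on f {..?m}"
      by (rule linorder_inj_onI) (use mono in \<open>fastforce+\<close>)
    show "f ` {..?m} \<subseteq> {..?n}" using f_le by auto
    fix p q assume pq: "p \<in> {..?m}" "q \<in> {..?m}" "p \<noteq> q"
    then have "min p q < ?m" by auto
    then have min: "w ! f (min p q) = u ! min p q" using f0(3)[of "min p q"] by (simp add: f_def)
    have "w ! f (max p q) = u ! max p q" if "max p q < ?m"
      using f0(3)[OF that] that by (simp add: f_def)
    with min show "?E u p q = ?E w (f p) (f q)"
      using pq minmax[of p q] f_le(2)[of "max p q"] by (auto simp: pos_edge_def)
  qed
  moreover have "(l \<circ> f) p = (if p < ?m then snd (snd (u ! p)) else x)"
    if "p \<le> ?m" "(if p < ?m then snd (snd (u ! p)) else x) < D" for p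
    using lr(2)[of "f p"] f_le[of p] f0(3)[of p] that by (auto simp: f_def split: if_splits)
  ultimately show ?thesis
    unfolding word_extendable_def extendable_def by blast
qed

section \<open>Recognising letter graphs\<close>

definition below :: "var \<Rightarrow> var \<Rightarrow> com \<Rightarrow> com" where
  "below x y c = For x (IfLess x y c SKIP)"

definition IfPos :: "var \<Rightarrow> com \<Rightarrow> com \<Rightarrow> com" where
  "IfPos x c1 c2 = IfLess Zero x c1 c2"

definition IfEq :: "var \<Rightarrow> var \<Rightarrow> com \<Rightarrow> com \<Rightarrow> com" where
  "IfEq x y c1 c2 = IfLess x y c2 (IfLess y x c2 c1)"

lemma exec_IfPos [simp]:
  "exec (IfPos x c1 c2) s = (if sc s Zero < sc s x then exec c1 s else exec c2 s)"
  by (simp add: IfPos_def)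

lemma exec_IfEq [simp]:
  "exec (IfEq x y c1 c2) s = (if sc s x = sc s y then exec c1 s else exec c2 s)"
  by (auto simp: IfEq_def)

lemma syntax_macros [simp]:
  "mod_vars (below x y c) = insert x (mod_vars c)"
  "mod_arrs (below x y c) = mod_arrs c"
  "input_free (below x y c) = input_free c"
  "wf_com (below x y c) \<longleftrightarrow> wf_com c \<and> x \<noteq> Size \<and> x \<notin> mod_vars c"
  "loop_depth (below x y c) = Suc (loop_depth c)"
  "mod_vars (IfPos z c1 c2) = mod_vars c1 \<union> mod_vars c2"
  "mod_arrs (IfPos z c1 c2) = mod_arrs c1 \<union> mod_arrs c2"
  "input_free (IfPos z c1 c2) \<longleftrightarrow> input_free c1 \<and> input_free c2"
  "wf_com (IfPos z c1 c2) \<longleftrightarrow> wf_com c1 \<and> wf_com c2"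
  "loop_depth (IfPos z c1 c2) = max (loop_depth c1) (loop_depth c2)"
  "mod_vars (IfEq x y c1 c2) = mod_vars c1 \<union> mod_vars c2"
  "mod_arrs (IfEq x y c1 c2) = mod_arrs c1 \<union> mod_arrs c2"
  "input_free (IfEq x y c1 c2) \<longleftrightarrow> input_free c1 \<and> input_free c2"
  "wf_com (IfEq x y c1 c2) \<longleftrightarrow> wf_com c1 \<and> wf_com c2"
  "loop_depth (IfEq x y c1 c2) = max (loop_depth c1) (loop_depth c2)"
  by (auto simp: below_def IfPos_def IfEq_def)

lemma exec_arrs: "mod_arrs c = {} \<Longrightarrow> ar (exec c s) = ar s"
  by (rule ext) (simp add: exec_arr)

definition frame :: "com \<Rightarrow> var set \<Rightarrow> store \<Rightarrow> store \<Rightarrow> bool" where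
  "frame c X s s' \<longleftrightarrow> (\<forall>v. v \<notin> X \<union> mod_vars c \<longrightarrow> sc s' v = sc s v) \<and>
    (\<forall>a. a \<notin> mod_arrs c \<longrightarrow> ar s' a = ar s a) \<and> (input_free c \<longrightarrow> inp s' = inp s)"

lemma frame_exec_set_var:
  "frame c {x} s s' \<Longrightarrow> frame c {x} s (exec c (set_var x v s'))"
  unfolding frame_def by (simp add: exec_var exec_arr exec_inp)

lemma For_rule:
  assumes init: "I 0 s"
    and step: "\<And>j s'. j < sc s Size \<Longrightarrow> I j s' \<Longrightarrow> frame c {x} s s' \<Longrightarrow>
      I (Suc j) (exec c (set_var x j s'))"
    and stable: "\<And>s' v. I (sc s Size) s' \<Longrightarrow> I (sc s Size) (set_var x v s')"
  shows "I (sc s Size) (exec (For x c) s)"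
proof -
  have "I (sc s Size) (fold (\<lambda>j s. exec c (set_var x j s)) [0..<sc s Size] s) \<and>
      frame c {x} s (fold (\<lambda>j s. exec c (set_var x j s)) [0..<sc s Size] s)"
    by (rule fold_invariant_upt[where I = "\<lambda>j s'. I j s' \<and> frame c {x} s s'"])
      (use init step in \<open>auto simp: frame_exec_set_var\<close>, simp add: frame_def)
  then show ?thesis using stable by simp
qed

lemma below_rule:
  assumes "sc s y \<le> sc s Size" "x \<noteq> y" "y \<notin> mod_vars c"
    and init: "I 0 s"
    and step: "\<And>j s'. j < sc s y \<Longrightarrow> I j s' \<Longrightarrow> frame c {x} s s' \<Longrightarrow>
      I (Suc j) (exec c (set_var x j s'))"
    and stable: "\<And>s' v. I (sc s y) s' \<Longrightarrow> I (sc s y) (set_var x v s')"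
  shows "I (sc s y) (exec (below x y c) s)"
proof -
  have "I (min (sc s Size) (sc s y)) (exec (below x y c) s)"
    unfolding below_def
  proof (rule For_rule[where I = "\<lambda>j. I (min j (sc s y))"])
    fix j s'
    assume *: "I (min j (sc s y)) s'" "frame (IfLess x y c SKIP) {x} s s'"
    then have y: "sc s' y = sc s y" and fr: "frame c {x} s s'"
      using assms(2,3) by (auto simp: frame_def)
    show "I (min (Suc j) (sc s y)) (exec (IfLess x y c SKIP) (set_var x j s'))"
    proof (cases "j < sc s y")
      case True
      then show ?thesis using * y fr step[of j s'] assms(2) by simp
    next
      case False
      then show ?thesis using * y stable[of s' j] assms(2) by (simp add: min_absorb2)
    qed
  qed (use init stable assms(1) in \<open>simp_all add: min_absorb2\<close>)
  then show ?thesis using assms(1) by (simp add: min_absorb2)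
qed

primrec switch :: "var \<Rightarrow> nat \<Rightarrow> (nat \<Rightarrow> com) \<Rightarrow> com" where
  "switch x 0 f = SKIP"
| "switch x (Suc m) f = (Const Const_Tmp m ;; IfEq x Const_Tmp (f m) (switch x m f))"

lemma exec_switch:
  "x \<noteq> Const_Tmp \<Longrightarrow> sc s x < m \<Longrightarrow>
    exec (switch x m f) s = exec (f (sc s x)) (set_var Const_Tmp (sc s x) s)"
  by (induction m arbitrary: s) (auto simp: less_Suc_eq)

lemma mod_vars_switch: "mod_vars (switch x m f) \<subseteq> insert Const_Tmp (\<Union>j. mod_vars (f j))"
  by (induction m) auto

lemma mod_arrs_switch: "mod_arrs (switch x m f) \<subseteq> (\<Union>j. mod_arrs (f j))"
  by (induction m) auto

lemma input_free_switch: "(\<And>j. input_free (f j)) \<Longrightarrow> input_free (switch x m f)"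
  by (induction m) auto

lemma wf_com_switch: "(\<And>j. wf_com (f j)) \<Longrightarrow> wf_com (switch x m f)"
  by (induction m) auto

lemma loop_depth_switch: "(\<And>j. loop_depth (f j) = 0) \<Longrightarrow> loop_depth (switch x m f) = 0"
  by (induction m) auto

locale recogniser =
  fixes D :: nat and A :: "nat \<Rightarrow> nat \<Rightarrow> bool"
    and m q0 :: nat and \<delta> :: "nat \<Rightarrow> nat \<times> nat \<times> nat \<Rightarrow> nat" and acc :: "nat \<Rightarrow> nat \<Rightarrow> bool"
  assumes q0: "q0 < m" and \<delta>: "\<And>q a. q < m \<Longrightarrow> \<delta> q a < m"
    and acc: "\<And>x w. x \<le> D \<Longrightarrow> w \<in> lists ({..<D} \<times> {..<2} \<times> {..D}) \<Longrightarrow>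
      acc (foldl \<delta> q0 w) x \<longleftrightarrow> word_extendable D A x w"
begin

definition ready :: "store \<Rightarrow> bool" where
  "ready s \<longleftrightarrow> sc s Zero = 0 \<and> sc s Cur < sc s Size \<and> sc s Next = Suc (sc s Cur) \<and>
    (\<forall>p < sc s Cur. ar s Label p < D \<and> ar s Adjacent p < 2)"

definition transition :: com where
  "transition = switch State m (\<lambda>q. switch Lab D (\<lambda>l. switch Adj 2 (\<lambda>d. switch Mark (Suc D)
    (\<lambda>k. Const State (\<delta> q (l, d, k))))))"

definition accept :: com where
  "accept = switch State m (\<lambda>q. switch Mark (Suc D) (\<lambda>k. Const Found (of_bool (acc q k))))"

definition decode :: "var \<Rightarrow> com" where
  "decode x = switch Lab D (\<lambda>a. switch Mark D (\<lambda>b. Const x (of_bool (A a b))))"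

lemma mod_vars_blocks:
  "mod_vars transition \<subseteq> {State, Const_Tmp}"
  "mod_vars accept \<subseteq> {Found, Const_Tmp}"
  "mod_vars (decode x) \<subseteq> {x, Const_Tmp}"
  unfolding transition_def accept_def decode_def
  by (rule order_trans[OF mod_vars_switch],
      auto dest!: subsetD[OF mod_vars_switch] simp del: switch.simps)+

lemma mod_arrs_blocks [simp]:
  "mod_arrs transition = {}" "mod_arrs accept = {}" "mod_arrs (decode x) = {}"
  unfolding transition_def accept_def decode_def
  by (auto dest!: subsetD[OF mod_arrs_switch] simp del: switch.simps)

lemma input_free_blocks [simp]:
  "input_free transition" "input_free accept" "input_free (decode x)"
  unfolding transition_def accept_def decode_def
  by (auto intro!: input_free_switch simp del: switch.simps)

lemma wf_com_blocks [simp]: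
  "wf_com transition" "wf_com accept" "x \<noteq> Size \<Longrightarrow> wf_com (decode x)"
  unfolding transition_def accept_def decode_def
  by (auto intro!: wf_com_switch simp del: switch.simps)

lemma loop_depth_blocks [simp]:
  "loop_depth transition = 0" "loop_depth accept = 0" "loop_depth (decode x) = 0"
  unfolding transition_def accept_def decode_def
  by (auto intro!: loop_depth_switch simp del: switch.simps)

lemma notin_mod_vars_blocks [simp]:
  "x \<noteq> State \<Longrightarrow> x \<noteq> Const_Tmp \<Longrightarrow> x \<notin> mod_vars transition"
  "x \<noteq> Found \<Longrightarrow> x \<noteq> Const_Tmp \<Longrightarrow> x \<notin> mod_vars accept"
  "x \<noteq> y \<Longrightarrow> x \<noteq> Const_Tmp \<Longrightarrow> x \<notin> mod_vars (decode y)"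
  using mod_vars_blocks by blast+

lemma exec_transition:
  assumes "sc s State < m" "sc s Lab < D" "sc s Adj < 2" "sc s Mark \<le> D"
  shows "sc (exec transition s) State = \<delta> (sc s State) (sc s Lab, sc s Adj, sc s Mark)"
  unfolding transition_def using assms by (simp add: exec_switch del: switch.simps)

lemma exec_accept:
  assumes "sc s State < m" "sc s Mark \<le> D"
  shows "sc (exec accept s) Found = of_bool (acc (sc s State) (sc s Mark))"
  unfolding accept_def using assms by (simp add: exec_switch del: switch.simps)

lemma exec_decode:
  assumes "sc s Lab < D" "sc s Mark < D"
  shows "sc (exec (decode x) s) x = of_bool (A (sc s Lab) (sc s Mark))"
  unfolding decode_def using assms by (simp add: exec_switch del: switch.simps)

definition run_automaton :: com where
  "run_automaton = Const State q0 ;;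
    below Scan Cur (Get Lab Label Scan ;; Get Adj Adjacent Scan ;; Get Mark Marking Scan ;; transition) ;;
    Get Mark Marking Cur ;; accept"

lemma run_automaton_syntax [simp]:
  "x \<notin> {State, Scan, Lab, Adj, Mark, Found, Const_Tmp} \<Longrightarrow> x \<notin> mod_vars run_automaton"
  "mod_arrs run_automaton = {}" "input_free run_automaton" "wf_com run_automaton"
  "loop_depth run_automaton = 1"
  by (auto simp: run_automaton_def)

lemma run_automaton_Found:
  assumes "ready s" and marks: "\<And>p. p \<le> sc s Cur \<Longrightarrow> ar s Marking p \<le> D"
  shows "sc (exec run_automaton s) Found =
    of_bool (extendable D A (sc s Cur) (ar s Label) (ar s Adjacent) (ar s Marking))"
proof -
  define letter where "letter p = (ar s Label p, ar s Adjacent p, ar s Marking p)" for p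
  define i where "i = sc s Cur"
  have range: "letter p \<in> {..<D} \<times> {..<2} \<times> {..D}" if "p < i" for p
    using assms that by (auto simp: ready_def letter_def i_def)
  let ?c = "Get Lab Label Scan ;; Get Adj Adjacent Scan ;; Get Mark Marking Scan ;; transition"
  let ?s1 = "set_var State q0 s"
  have "(\<lambda>j s'. sc s' State < m \<and> sc s' State = foldl \<delta> q0 (map letter [0..<j]))
      (sc ?s1 Cur) (exec (below Scan Cur ?c) ?s1)"
  proof (rule below_rule)
    fix j s'
    assume j: "j < sc ?s1 Cur"
      and inv: "sc s' State < m \<and> sc s' State = foldl \<delta> q0 (map letter [0..<j])"
      and fr: "frame ?c {Scan} ?s1 s'"
    have ar: "ar s' = ar s" using fr by (auto simp: frame_def)
    have "letter j \<in> {..<D} \<times> {..<2} \<times> {..D}" using range j by (simp add: i_def)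
    then show "sc (exec ?c (set_var Scan j s')) State < m \<and>
        sc (exec ?c (set_var Scan j s')) State = foldl \<delta> q0 (map letter [0..<Suc j])"
      using inv by (simp add: exec_transition ar letter_def \<delta>)
  qed (use assms q0 in \<open>auto simp: ready_def\<close>)
  then have st: "sc (exec (below Scan Cur ?c) ?s1) State < m"
    "sc (exec (below Scan Cur ?c) ?s1) State = foldl \<delta> q0 (map letter [0..<i])"
    by (auto simp: i_def)
  have fr: "sc (exec (below Scan Cur ?c) ?s1) Cur = i" "ar (exec (below Scan Cur ?c) ?s1) = ar s"
    by (auto simp: exec_var exec_arr i_def)
  have "sc (exec run_automaton s) Found = of_bool (acc (foldl \<delta> q0 (map letter [0..<i])) (ar s Marking i))"
    unfolding run_automaton_def using st fr marks[of i] by (simp add: exec_accept i_def)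
  also have "acc (foldl \<delta> q0 (map letter [0..<i])) (ar s Marking i) \<longleftrightarrow>
      word_extendable D A (ar s Marking i) (map letter [0..<i])"
  proof (rule acc)
    show "map letter [0..<i] \<in> lists ({..<D} \<times> {..<2} \<times> {..D})"
      unfolding in_lists_conv_set set_map ball_simps using range by simp
  qed (use marks in \<open>simp add: i_def\<close>)
  also have "\<dots> \<longleftrightarrow> extendable D A i (ar s Label) (ar s Adjacent) (ar s Marking)"
    unfolding word_extendable_def length_map length_upt diff_zero
    by (rule extendable_cong) (auto simp: letter_def)
  finally show ?thesis by (simp add: i_def)
qed

abbreviation ext :: "store \<Rightarrow> (nat \<Rightarrow> nat) \<Rightarrow> bool" where
  "ext s mark \<equiv> extendable D A (sc s Cur) (ar s Label) (ar s Adjacent) mark"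

primrec try_marks :: "nat \<Rightarrow> com" where
  "try_marks 0 = SKIP"
| "try_marks (Suc a) = (try_marks a ;;
    IfPos Found SKIP (Const Val a ;; Put Marking PosP Val ;; run_automaton))"

lemma try_marks_syntax [simp]:
  "x \<notin> {Val, State, Scan, Lab, Adj, Mark, Found, Const_Tmp} \<Longrightarrow> x \<notin> mod_vars (try_marks a)"
  "b \<noteq> Marking \<Longrightarrow> b \<notin> mod_arrs (try_marks a)" "input_free (try_marks a)" "wf_com (try_marks a)"
  "loop_depth (try_marks a) \<le> Suc 0"
  by (induction a) auto

lemma try_marks:
  assumes "ready s" "\<And>p. p \<le> sc s Cur \<Longrightarrow> ar s Marking p \<le> D" "sc s PosP \<le> sc s Cur"
    and "sc s Found = 0" "a \<le> D"
  shows "\<exists>b \<le> D. ar (exec (try_marks a) s) Marking = (ar s Marking)(sc s PosP := b) \<and>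
    (sc (exec (try_marks a) s) Found = 1 \<and> b < D \<and> ext s ((ar s Marking)(sc s PosP := b)) \<or>
     sc (exec (try_marks a) s) Found = 0 \<and> (\<forall>b'<a. \<not> ext s ((ar s Marking)(sc s PosP := b'))))"
  using \<open>a \<le> D\<close>
proof (induction a)
  case 0
  show ?case using assms by (intro exI[of _ "ar s Marking (sc s PosP)"]) simp
next
  case (Suc a)
  let ?p = "sc s PosP"
  let ?s1 = "exec (try_marks a) s"
  have "a \<le> D" using Suc.prems by simp
  from Suc.IH[OF this] obtain b where b: "b \<le> D" "ar ?s1 Marking = (ar s Marking)(?p := b)" and
    found: "sc ?s1 Found = 1 \<and> b < D \<and> ext s ((ar s Marking)(?p := b)) \<or>
     sc ?s1 Found = 0 \<and> (\<forall>b'<a. \<not> ext s ((ar s Marking)(?p := b')))" by blast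
  have fr: "sc ?s1 x = sc s x" if "x \<in> {Zero, PosP, Cur, Next, Size}" for x
    by (rule exec_var) (use that in auto)
  have fr': "ar ?s1 Label = ar s Label" "ar ?s1 Adjacent = ar s Adjacent"
    by (auto simp: exec_arr)
  show ?case
  proof (cases "sc ?s1 Found = 1")
    case True
    then have run: "exec (try_marks (Suc a)) s = ?s1"
      using assms(1) fr by (simp add: ready_def)
    have "b < D" "ext s ((ar s Marking)(?p := b))" using found True by auto
    then show ?thesis unfolding run using b True by blast
  next
    case False
    then have none: "sc ?s1 Found = 0" "\<forall>b'<a. \<not> ext s ((ar s Marking)(?p := b'))"
      using found by auto
    define s2 where "s2 = exec (Put Marking PosP Val) (exec (Const Val a) ?s1)"
    have exec: "exec (try_marks (Suc a)) s = exec run_automaton s2"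
      using none(1) by (simp add: s2_def)
    have ar2: "ar s2 Marking = (ar s Marking)(?p := a)" "ar s2 Label = ar s Label"
      "ar s2 Adjacent = ar s Adjacent"
      by (auto simp: s2_def b fr fr')
    have sc2: "sc s2 x = sc s x" if "x \<in> {Zero, PosP, Cur, Next, Size}" for x
      using that fr[OF that] by (auto simp: s2_def)
    have "sc (exec run_automaton s2) Found = of_bool (ext s2 (ar s2 Marking))"
    proof (rule run_automaton_Found)
      show "ready s2" using assms(1) by (simp add: ready_def sc2 ar2)
      show "ar s2 Marking p \<le> D" if "p \<le> sc s2 Cur" for p
        using that assms(2) Suc.prems by (simp add: ar2 sc2)
    qed
    then have found2: "sc (exec run_automaton s2) Found = of_bool (ext s ((ar s Marking)(?p := a)))"
      by (simp add: ar2 sc2)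
    have "ar (exec run_automaton s2) Marking = (ar s Marking)(?p := a)"
      by (simp add: exec_arr ar2)
    then show ?thesis
      unfolding exec using found2 none(2) Suc.prems
      by (intro exI[of _ a]) (auto simp: less_Suc_eq simp del: fun_upd_apply)
  qed
qed

definition choose_mark :: com where
  "choose_mark = Const Found 0 ;; try_marks D ;; IfPos Found SKIP (Const Fail 1)"

lemma choose_mark_syntax [simp]:
  "x \<notin> {Fail, Val, State, Scan, Lab, Adj, Mark, Found, Const_Tmp} \<Longrightarrow> x \<notin> mod_vars choose_mark"
  "b \<noteq> Marking \<Longrightarrow> b \<notin> mod_arrs choose_mark" "input_free choose_mark" "wf_com choose_mark"
  "loop_depth choose_mark \<le> Suc 0"
  by (auto simp: choose_mark_def)

definition mark_all :: com where
  "mark_all = below PosP Next (IfPos Fail SKIP choose_mark)"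

lemma mark_all_syntax [simp]:
  "x \<notin> {PosP, Fail, Val, State, Scan, Lab, Adj, Mark, Found, Const_Tmp} \<Longrightarrow> x \<notin> mod_vars mark_all"
  "b \<noteq> Marking \<Longrightarrow> b \<notin> mod_arrs mark_all" "input_free mark_all" "wf_com mark_all"
  "loop_depth mark_all \<le> 2"
  by (auto simp: mark_all_def)

lemma mark_all_Fail:
  assumes "ready s" "sc s Fail = 0" and open_marks: "\<And>p. p \<le> sc s Cur \<Longrightarrow> ar s Marking p = D"
  defines "s' \<equiv> exec mark_all s"
  shows "sc s' Fail = 0 \<and> (\<forall>p \<le> sc s Cur. ar s' Marking p < D) \<and> ext s (ar s' Marking) \<or>
    sc s' Fail = 1 \<and> \<not> ext s (ar s Marking)"
proof -
  define i where "i = sc s Cur"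
  have Next: "sc s Next = Suc i" using assms(1) by (simp add: ready_def i_def)
  define I where "I j s' \<longleftrightarrow>
    sc s' Fail = 0 \<and> (\<forall>p<j. ar s' Marking p < D) \<and> (\<forall>p. j \<le> p \<longrightarrow> p \<le> i \<longrightarrow> ar s' Marking p = D) \<and>
      (ext s (ar s' Marking) \<longleftrightarrow> ext s (ar s Marking)) \<and> (0 < j \<longrightarrow> ext s (ar s' Marking)) \<or>
    sc s' Fail = 1 \<and> \<not> ext s (ar s Marking)" for j :: nat and s' :: store
  have "I (sc s Next) (exec mark_all s)"
    unfolding mark_all_def
  proof (rule below_rule)
    show "sc s Next \<le> sc s Size" using assms(1) by (simp add: ready_def)
    show "I 0 s" using assms(2) open_marks by (simp add: I_def i_def)
    show "I (sc s Next) (set_var PosP v s')" if "I (sc s Next) s'" for s' v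
      using that by (simp add: I_def)
    fix j s'
    assume j: "j < sc s Next" and inv: "I j s'" and fr: "frame (IfPos Fail SKIP choose_mark) {PosP} s s'"
    let ?s1 = "set_var PosP j s'"
    have sc: "sc s' x = sc s x" if "x \<in> {Zero, Cur, Next, Size}" for x
      using fr that by (auto simp: frame_def)
    have ar: "ar s' Label = ar s Label" "ar s' Adjacent = ar s Adjacent"
      using fr by (auto simp: frame_def)
    have Zero: "sc s Zero = 0" using assms(1) by (simp add: ready_def)
    show "I (Suc j) (exec (IfPos Fail SKIP choose_mark) ?s1)"
    proof (cases "sc s' Fail = 0")
      case False
      then show ?thesis using inv sc Zero by (auto simp: I_def)
    next
      case True
      then have inv: "\<forall>p<j. ar s' Marking p < D" "\<forall>p. j \<le> p \<longrightarrow> p \<le> i \<longrightarrow> ar s' Marking p = D"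
        "ext s (ar s' Marking) \<longleftrightarrow> ext s (ar s Marking)"
        using inv by (auto simp: I_def)
      let ?s2 = "set_var Found 0 ?s1"
      let ?s3 = "exec (try_marks D) ?s2"
      have "\<exists>b \<le> D. ar ?s3 Marking = (ar ?s2 Marking)(sc ?s2 PosP := b) \<and>
        (sc ?s3 Found = 1 \<and> b < D \<and> ext ?s2 ((ar ?s2 Marking)(sc ?s2 PosP := b)) \<or>
         sc ?s3 Found = 0 \<and> (\<forall>b'<D. \<not> ext ?s2 ((ar ?s2 Marking)(sc ?s2 PosP := b'))))"
      proof (rule try_marks)
        show "ready ?s2" using assms(1) by (simp add: ready_def sc ar)
        show "ar ?s2 Marking p \<le> D" if "p \<le> sc ?s2 Cur" for p
          using that inv(1,2) by (cases "p < j") (auto simp: sc i_def less_imp_le)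
        show "sc ?s2 PosP \<le> sc ?s2 Cur" using j Next by (simp add: sc i_def)
      qed auto
      then obtain b where b: "ar ?s3 Marking = (ar s' Marking)(j := b)"
        and found: "sc ?s3 Found = 1 \<and> b < D \<and> ext s ((ar s' Marking)(j := b)) \<or>
         sc ?s3 Found = 0 \<and> (\<forall>b'<D. \<not> ext s ((ar s' Marking)(j := b')))"
        by (auto simp: sc ar)
      have "D \<le> ar s' Marking j" "j \<le> sc s Cur" using inv(2) j Next by (auto simp: i_def)
      from extendable_mark[where mark = "ar s' Marking", OF this(2,1)]
      have ex: "ext s (ar s' Marking) \<longleftrightarrow> (\<exists>b'<D. ext s ((ar s' Marking)(j := b')))" .
      have fr3: "sc ?s3 Zero = 0" "sc ?s3 Fail = 0" by (simp_all add: exec_var sc Zero True)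
      have run: "exec (IfPos Fail SKIP choose_mark) ?s1 = (if sc ?s3 Found = 0 then set_var Fail 1 ?s3 else ?s3)"
        using True Zero sc fr3 by (simp add: choose_mark_def)
      show ?thesis
      proof (cases "sc ?s3 Found = 0")
        case True
        then have "\<not> ext s (ar s Marking)" using found ex inv(3) by auto
        then show ?thesis unfolding run using True by (simp add: I_def)
      next
        case False
        then have *: "b < D" "ext s ((ar s' Marking)(j := b))" using found by auto
        then have "ext s (ar s Marking)" using ex inv(3) by blast
        moreover define M where "M = (ar s' Marking)(j := b)"
        moreover have "\<forall>p<Suc j. M p < D" "\<forall>p. Suc j \<le> p \<longrightarrow> p \<le> i \<longrightarrow> M p = D"
          using inv(1,2) *(1) by (auto simp: M_def less_Suc_eq)
        ultimately show ?thesis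
          unfolding run using False * fr3 b by (simp add: I_def del: fun_upd_apply)
      qed
    qed
  qed auto
  then show ?thesis
    by (auto simp: I_def Next s'_def i_def[symmetric] less_Suc_eq_le)
qed

definition edge :: "var \<Rightarrow> var \<Rightarrow> com" where
  "edge x y = IfLess y Cur (Get Lab Label x ;; Get Mark Label y ;; decode Edge) (Get Edge Adjacent x)"

definition conflict_test :: com where
  "conflict_test = IfLess PosP PosQ (edge PosP PosQ) (edge PosQ PosP) ;;
    Get Lab Marking PosP ;; Get Mark Marking PosQ ;; decode Bad ;;
    IfEq Edge Bad (Const Bad 0) (Const Bad 1) ;; IfEq PosP PosQ (Const Bad 0) SKIP"

lemma conflict_test_syntax [simp]:
  "x \<notin> {Lab, Mark, Edge, Bad, Const_Tmp} \<Longrightarrow> x \<notin> mod_vars conflict_test"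
  "mod_arrs conflict_test = {}" "input_free conflict_test" "wf_com conflict_test"
  "loop_depth conflict_test = 0"
  by (auto simp: conflict_test_def edge_def)

text \<open>A conflict between \<open>p\<close> and \<open>q\<close> forbids \<open>p\<close> to precede \<open>q\<close> in the new word.\<close>

definition conflict :: "store \<Rightarrow> nat \<Rightarrow> nat \<Rightarrow> bool" where
  "conflict s p q \<longleftrightarrow> p \<noteq> q \<and>
    pos_edge A (sc s Cur) (ar s Label) (ar s Adjacent) p q \<noteq> A (ar s Marking p) (ar s Marking q)"

definition sortable :: "store \<Rightarrow> bool" where
  "sortable s \<longleftrightarrow> ready s \<and> (\<forall>p \<le> sc s Cur. ar s Marking p < D)"

lemma conflict_test_Bad:
  assumes "sortable s" "sc s PosP \<le> sc s Cur" "sc s PosQ \<le> sc s Cur"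
  shows "sc (exec conflict_test s) Bad = of_bool (conflict s (sc s PosP) (sc s PosQ))"
proof -
  let ?p = "sc s PosP" and ?q = "sc s PosQ"
  let ?E = "pos_edge A (sc s Cur) (ar s Label) (ar s Adjacent) ?p ?q"
  have edge_frame: "sc (exec (edge x y) s) z = sc s z" if "z \<notin> {Lab, Mark, Edge, Const_Tmp}" for x y z
    using that by (intro exec_var) (auto simp: edge_def)
  have edge_arr: "ar (exec (edge x y) s) = ar s" for x y
    by (rule exec_arrs) (simp add: edge_def)
  define s1 where "s1 = exec (IfLess PosP PosQ (edge PosP PosQ) (edge PosQ PosP)) s"
  have s1: "sc s1 PosP = ?p" "sc s1 PosQ = ?q" "ar s1 = ar s"
    by (simp_all add: s1_def edge_frame edge_arr)
  have edge: "sc (exec (edge x y) s) Edge =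
      of_bool (pos_edge A (sc s Cur) (ar s Label) (ar s Adjacent) (sc s x) (sc s y))"
    if "sc s x < sc s y" "sc s y \<le> sc s Cur" "y \<noteq> Lab" for x y
  proof (cases "sc s y < sc s Cur")
    case True
    then have "ar s Label (sc s x) < D" "ar s Label (sc s y) < D"
      using assms(1) that by (auto simp: sortable_def ready_def)
    then show ?thesis using True that by (simp add: edge_def exec_decode pos_edge_def min_def max_def)
  next
    case False
    then have "ar s Adjacent (sc s x) < 2"
      using assms(1) that by (auto simp: sortable_def ready_def)
    then show ?thesis using False that by (auto simp: edge_def pos_edge_def min_def max_def less_2_cases_iff)
  qed
  have sym: "?E = pos_edge A (sc s Cur) (ar s Label) (ar s Adjacent) ?q ?p"
    by (simp add: pos_edge_def min.commute max.commute)
  have Edge: "sc s1 Edge = of_bool ?E" if "?p \<noteq> ?q"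
    using edge[of PosP PosQ] edge[of PosQ PosP] sym that assms(2,3) by (simp add: s1_def)
  define s2 where
    "s2 = exec (decode Bad) (exec (Get Mark Marking PosQ) (exec (Get Lab Marking PosP) s1))"
  have "ar s Marking ?p < D" "ar s Marking ?q < D"
    using assms by (auto simp: sortable_def)
  then have s2: "sc s2 Bad = of_bool (A (ar s Marking ?p) (ar s Marking ?q))"
    "sc s2 Edge = sc s1 Edge" "sc s2 PosP = ?p" "sc s2 PosQ = ?q"
    using s1 by (simp_all add: s2_def exec_decode exec_var)
  have "exec conflict_test s = exec (IfEq PosP PosQ (Const Bad 0) SKIP)
      (exec (IfEq Edge Bad (Const Bad 0) (Const Bad 1)) s2)"
    by (simp only: conflict_test_def exec.simps s1_def s2_def)
  then show ?thesis
    using Edge s2 by (cases "?p = ?q") (simp_all add: conflict_def)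
qed

lemma conflict_cong:
  assumes "sc s' Cur = sc s Cur" "ar s' Label = ar s Label" "ar s' Adjacent = ar s Adjacent"
    "ar s' Marking = ar s Marking"
  shows "conflict s' = conflict s"
  by (intro ext) (simp add: conflict_def assms)

lemma sortable_cong:
  assumes "\<And>x. x \<in> {Zero, Cur, Next, Size} \<Longrightarrow> sc s' x = sc s x"
    and "ar s' Label = ar s Label" "ar s' Adjacent = ar s Adjacent" "ar s' Marking = ar s Marking"
  shows "sortable s' = sortable s"
  using assms by (simp add: sortable_def ready_def)

definition count_conflicts :: com where
  "count_conflicts = below PosP Next (Const Count 0 ;;
    below PosQ Next (conflict_test ;; IfPos Bad (Inc Count) SKIP) ;;
    Put Degree PosP Count ;; Put Removed PosP Zero)"

lemma count_conflicts_syntax [simp]: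
  "x \<notin> {PosP, PosQ, Count, Lab, Mark, Edge, Bad, Const_Tmp} \<Longrightarrow> x \<notin> mod_vars count_conflicts"
  "mod_arrs count_conflicts = {Degree, Removed}" "input_free count_conflicts"
  "wf_com count_conflicts" "loop_depth count_conflicts = 2"
  by (auto simp: count_conflicts_def)

lemma count_conflicts:
  assumes "sortable s" "p \<le> sc s Cur"
  shows "ar (exec count_conflicts s) Degree p = card {q. q \<le> sc s Cur \<and> conflict s p q}"
    and "ar (exec count_conflicts s) Removed p = 0"
proof -
  let ?inner = "conflict_test ;; IfPos Bad (Inc Count) SKIP"
  let ?c = "Const Count 0 ;; below PosQ Next ?inner ;; Put Degree PosP Count ;; Put Removed PosP Zero"
  have Next: "sc s Next = Suc (sc s Cur)" "sc s Next \<le> sc s Size" "sc s Zero = 0"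
    using assms(1) by (auto simp: sortable_def ready_def)
  have count: "sc (exec (below PosQ Next ?inner) s1) Count =
      card {q. q < sc s Next \<and> conflict s (sc s1 PosP) q}"
    if sc1: "\<And>x. x \<in> {Zero, Cur, Next, Size} \<Longrightarrow> sc s1 x = sc s x"
      and ar1: "\<And>a. a \<in> {Label, Adjacent, Marking} \<Longrightarrow> ar s1 a = ar s a"
      and s1: "sc s1 Count = 0" "sc s1 PosP \<le> sc s Cur" for s1
  proof -
    let ?I = "\<lambda>j s'. sc s' Count = card {q. q < j \<and> conflict s (sc s1 PosP) q}"
    have "?I (sc s1 Next) (exec (below PosQ Next ?inner) s1)"
    proof (rule below_rule[where I = ?I])
      fix j s'
      assume j: "j < sc s1 Next" and inv: "sc s' Count = card {q. q < j \<and> conflict s (sc s1 PosP) q}"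
        and fr: "frame ?inner {PosQ} s1 s'"
      define s2 where "s2 = set_var PosQ j s'"
      have sc2: "sc s2 x = sc s x" if "x \<in> {Zero, Cur, Next, Size}" for x
        using fr sc1[OF that] that by (auto simp: frame_def s2_def)
      have ar2: "ar s2 a = ar s a" if "a \<in> {Label, Adjacent, Marking}" for a
        using fr ar1[OF that] by (auto simp: frame_def s2_def)
      have PosP: "sc s2 PosP = sc s1 PosP" "sc s2 PosQ = j"
        using fr by (auto simp: frame_def s2_def)
      have "sortable s2" using assms(1) sc2 ar2 sortable_cong[of s2 s] by blast
      moreover have "conflict s2 = conflict s" using sc2 ar2 by (intro conflict_cong) auto
      ultimately have Bad: "sc (exec conflict_test s2) Bad = of_bool (conflict s (sc s1 PosP) j)"
        using conflict_test_Bad[of s2] PosP s1 j sc1[of Next] sc2[of Cur] Next by simp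
      have "card {q. q < j \<and> conflict s (sc s1 PosP) q} \<le> card {..<j}"
        by (rule card_mono) auto
      then have lt: "card {q. q < j \<and> conflict s (sc s1 PosP) q} < sc s Size"
        using j sc1[of Next] Next by simp
      have "{q. q < Suc j \<and> conflict s (sc s1 PosP) q} =
          (if conflict s (sc s1 PosP) j then insert j {q. q < j \<and> conflict s (sc s1 PosP) q}
           else {q. q < j \<and> conflict s (sc s1 PosP) q})"
        by (auto simp: less_Suc_eq)
      moreover have "sc (exec conflict_test s2) Count = sc s' Count"
        "sc (exec conflict_test s2) Size = sc s Size" "sc (exec conflict_test s2) Zero = 0"
        using sc2[of Size] sc2[of Zero] Next by (simp_all add: exec_var) (simp add: s2_def)
      ultimately show "sc (exec ?inner (set_var PosQ j s')) Count = card {q. q < Suc j \<and> conflict s (sc s1 PosP) q}"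
        using inv lt Bad by (simp add: s2_def[symmetric])
    qed (use s1 sc1 Next in auto)
    then show ?thesis using sc1[of Next] by simp
  qed
  let ?I = "\<lambda>j s'. \<forall>p<j. ar s' Degree p = card {q. q < sc s Next \<and> conflict s p q} \<and> ar s' Removed p = 0"
  have "?I (sc s Next) (exec count_conflicts s)"
    unfolding count_conflicts_def
  proof (rule below_rule[where I = ?I])
    fix j s'
    assume j: "j < sc s Next"
      and inv: "\<forall>p<j. ar s' Degree p = card {q. q < sc s Next \<and> conflict s p q} \<and> ar s' Removed p = 0"
      and fr: "frame ?c {PosP} s s'"
    define s1 where "s1 = exec (Const Count 0) (set_var PosP j s')"
    define s2 where "s2 = exec (below PosQ Next ?inner) s1"
    have sc1: "sc s1 x = sc s x" if "x \<in> {Zero, Cur, Next, Size}" for x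
      using fr that by (auto simp: frame_def s1_def)
    have ar1: "ar s1 a = ar s a" if "a \<in> {Label, Adjacent, Marking}" for a
      using fr that by (auto simp: frame_def s1_def)
    have j1: "sc s1 PosP = j" "sc s1 Count = 0" "ar s1 = ar s'" by (simp_all add: s1_def)
    have "sc s2 Count = card {q. q < sc s Next \<and> conflict s j q}"
      unfolding s2_def using count[OF sc1 ar1] j j1 Next by simp
    moreover have "sc s2 PosP = j" "sc s2 Zero = 0" "ar s2 = ar s'"
      using j1 sc1[of Zero] Next by (simp_all add: s2_def exec_var exec_arrs)
    moreover have "exec ?c (set_var PosP j s') = exec (Put Removed PosP Zero) (exec (Put Degree PosP Count) s2)"
      by (simp add: s1_def s2_def)
    ultimately show "\<forall>p<Suc j. ar (exec ?c (set_var PosP j s')) Degree p =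
        card {q. q < sc s Next \<and> conflict s p q} \<and> ar (exec ?c (set_var PosP j s')) Removed p = 0"
      using inv by (auto simp: less_Suc_eq)
  qed (use Next in auto)
  then show "ar (exec count_conflicts s) Degree p = card {q. q \<le> sc s Cur \<and> conflict s p q}"
    "ar (exec count_conflicts s) Removed p = 0"
    using assms(2) Next(1) by (auto simp: less_Suc_eq_le)
qed

definition select :: com where
  "select = below PosP Next (Get Val Removed PosP ;; IfPos Val SKIP
    (Get Val Degree PosP ;; IfPos Val SKIP (Copy PosQ PosP)))"

lemma select_syntax [simp]:
  "x \<notin> {PosP, PosQ, Val} \<Longrightarrow> x \<notin> mod_vars select"
  "mod_arrs select = {}" "input_free select" "wf_com select" "loop_depth select = 1"
  by (auto simp: select_def)

lemma select:
  assumes "sc s Zero = 0" "sc s Next \<le> sc s Size"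
    and "p < sc s Next" "ar s Removed p = 0" "ar s Degree p = 0"
  defines "q \<equiv> sc (exec select s) PosQ"
  shows "q < sc s Next" "ar s Removed q = 0" "ar s Degree q = 0"
proof -
  let ?c = "Get Val Removed PosP ;; IfPos Val SKIP
    (Get Val Degree PosP ;; IfPos Val SKIP (Copy PosQ PosP))"
  let ?ok = "\<lambda>q. ar s Removed q = 0 \<and> ar s Degree q = 0"
  let ?I = "\<lambda>j s'. (\<exists>p<j. ?ok p) \<longrightarrow> sc s' PosQ < sc s Next \<and> ?ok (sc s' PosQ)"
  have "?I (sc s Next) (exec select s)"
    unfolding select_def
  proof (rule below_rule[where I = ?I])
    fix j s'
    assume j: "j < sc s Next"
      and inv: "(\<exists>p<j. ?ok p) \<longrightarrow> sc s' PosQ < sc s Next \<and> ?ok (sc s' PosQ)"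
      and fr: "frame ?c {PosP} s s'"
    have "sc s' Zero = 0" "ar s' = ar s"
      using fr assms(1) by (auto simp: frame_def)
    then show "(\<exists>p<Suc j. ?ok p) \<longrightarrow> sc (exec ?c (set_var PosP j s')) PosQ < sc s Next \<and>
        ?ok (sc (exec ?c (set_var PosP j s')) PosQ)"
      using inv j by (auto simp: less_Suc_eq)
  qed (use assms in auto)
  then show "q < sc s Next" "ar s Removed q = 0" "ar s Degree q = 0"
    using assms by auto
qed

definition remove_next :: com where
  "remove_next = select ;; Const Val 1 ;; Put Removed PosQ Val ;;
    Get Val Vertex PosQ ;; Put New_Vertex Round Val ;;
    Get Val Marking PosQ ;; Put New_Label Round Val ;;
    below PosP Next (conflict_test ;;
      IfPos Bad (Get Count Degree PosP ;; Dec Count ;; Put Degree PosP Count) SKIP)"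

lemma remove_next_syntax [simp]:
  "x \<notin> {PosP, PosQ, Val, Count, Lab, Mark, Edge, Bad, Const_Tmp} \<Longrightarrow> x \<notin> mod_vars remove_next"
  "mod_arrs remove_next = {Removed, New_Vertex, New_Label, Degree}" "input_free remove_next"
  "wf_com remove_next" "loop_depth remove_next = 1"
  by (auto simp: remove_next_def)

text \<open>
  After \<open>r\<close> rounds, the positions \<open>\<sigma> 0, \<dots>, \<sigma> (r - 1)\<close> have been removed in this order, and
  \<open>Degree\<close> counts the conflicts with the remaining positions.
\<close>

definition sorted_upto :: "store \<Rightarrow> nat \<Rightarrow> (nat \<Rightarrow> nat) \<Rightarrow> store \<Rightarrow> bool" where
  "sorted_upto s r \<sigma> s' \<longleftrightarrow> inj_on \<sigma> {..<r} \<and> \<sigma> ` {..<r} \<subseteq> {..sc s Cur} \<and>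
    (\<forall>p \<le> sc s Cur. ar s' Removed p = of_bool (p \<in> \<sigma> ` {..<r}) \<and>
      ar s' Degree p = card {q. q \<le> sc s Cur \<and> q \<notin> \<sigma> ` {..<r} \<and> conflict s p q}) \<and>
    (\<forall>a<r. ar s' New_Vertex a = ar s Vertex (\<sigma> a) \<and> ar s' New_Label a = ar s Marking (\<sigma> a)) \<and>
    (\<forall>a<r. \<forall>q \<le> sc s Cur. q \<notin> \<sigma> ` {..a} \<longrightarrow> \<not> conflict s (\<sigma> a) q)"

lemma remove_next:
  assumes "sortable s" and rep: "represents D A (pos_edge A (sc s Cur) (ar s Label) (ar s Adjacent))
      {..sc s Cur} (ar s Marking) rk"
    and sc: "\<And>x. x \<in> {Zero, Cur, Next, Size} \<Longrightarrow> sc s' x = sc s x"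
    and ar: "\<And>a. a \<in> {Label, Adjacent, Marking, Vertex} \<Longrightarrow> ar s' a = ar s a"
    and r: "sc s' Round = r" "r < sc s Next" and inv: "sorted_upto s r \<sigma> s'"
  shows "\<exists>\<sigma>'. sorted_upto s (Suc r) \<sigma>' (exec remove_next s')"
proof -
  define i where "i = sc s Cur"
  have Next: "sc s Next = Suc i" "sc s Next \<le> sc s Size" "sc s Zero = 0"
    using assms(1) by (auto simp: sortable_def ready_def i_def)
  define T where "T = \<sigma> ` {..<r}"
  have inv: "inj_on \<sigma> {..<r}" "T \<subseteq> {..i}" "\<And>p. p \<le> i \<Longrightarrow> ar s' Removed p = of_bool (p \<in> T)"
    "\<And>p. p \<le> i \<Longrightarrow> ar s' Degree p = card {q. q \<le> i \<and> q \<notin> T \<and> conflict s p q}"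
    "\<And>a. a < r \<Longrightarrow> ar s' New_Vertex a = ar s Vertex (\<sigma> a) \<and> ar s' New_Label a = ar s Marking (\<sigma> a)"
    "\<And>a q. a < r \<Longrightarrow> q \<le> i \<Longrightarrow> q \<notin> \<sigma> ` {..a} \<Longrightarrow> \<not> conflict s (\<sigma> a) q"
    using inv by (auto simp: sorted_upto_def i_def T_def)
  have "card T = r" using inv(1) by (simp add: T_def card_image)
  then have "{..i} - T \<noteq> {}"
    using r(2) Next(1) inv(2) card_mono[of T "{..i}"] finite_subset[OF inv(2)] by auto
  then obtain p0 where "p0 \<in> {..i} - T" by blast
  then obtain p where p: "p \<in> {..i} - T" and min: "\<And>q. q \<in> {..i} - T \<Longrightarrow> rk p \<le> rk q"
    using ex_has_least_nat[of "\<lambda>p. p \<in> {..i} - T" p0 rk] by blast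
  have "\<not> conflict s p q" if "q \<in> {..i} - T" for q
  proof (cases "p = q")
    case False
    have "rk p \<noteq> rk q" using rep False p that by (auto simp: represents_def i_def dest: inj_onD)
    then have "rk p < rk q" using min[OF that] by simp
    then show ?thesis using rep p that by (auto simp: represents_def conflict_def i_def)
  qed (simp add: conflict_def)
  then have "ar s' Degree p = 0" using inv(4) p by auto
  moreover have "ar s' Removed p = 0" using inv(3) p by auto
  ultimately have sel: "sc (exec select s') PosQ < sc s' Next"
    "ar s' Removed (sc (exec select s') PosQ) = 0" "ar s' Degree (sc (exec select s') PosQ) = 0"
    using select[of s' p] p sc Next by auto
  define q where "q = sc (exec select s') PosQ"
  have q: "q \<le> i" "q \<notin> T" using sel(1,2) sc[of Next] Next inv(3)[of q] by (auto simp: q_def split: if_splits)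
  then have "card {q'. q' \<le> i \<and> q' \<notin> T \<and> conflict s q q'} = 0"
    using inv(4) sel(3) by (simp add: q_def)
  then have q_free: "\<not> conflict s q q'" if "q' \<le> i" "q' \<notin> T" for q'
    using that by auto
  let ?upd = "conflict_test ;; IfPos Bad (Get Count Degree PosP ;; Dec Count ;; Put Degree PosP Count) SKIP"
  define s1 where "s1 = exec (Const Val 1 ;; Put Removed PosQ Val ;;
    Get Val Vertex PosQ ;; Put New_Vertex Round Val ;;
    Get Val Marking PosQ ;; Put New_Label Round Val) (exec select s')"
  have sel_fr: "sc (exec select s') x = sc s' x" if "x \<notin> {PosP, PosQ, Val}" for x
    using that by (intro exec_var) simp
  have s1: "ar s1 Removed = (ar s' Removed)(q := 1)" "ar s1 Degree = ar s' Degree"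
    "ar s1 New_Vertex = (ar s' New_Vertex)(r := ar s Vertex q)"
    "ar s1 New_Label = (ar s' New_Label)(r := ar s Marking q)"
    "sc s1 PosQ = q"
    using ar r by (simp_all add: s1_def exec_arrs q_def sel_fr)
  have sc1: "sc s1 x = sc s x" if "x \<in> {Zero, Cur, Next, Size}" for x
    using that sc[OF that] sel_fr[of x] by (auto simp: s1_def)
  have ar1: "ar s1 a = ar s a" if "a \<in> {Label, Adjacent, Marking}" for a
    using that ar[of a] by (auto simp: s1_def exec_arrs)
  have run: "exec remove_next s' = exec (below PosP Next ?upd) s1"
    by (simp add: remove_next_def s1_def)
  let ?I = "\<lambda>j s2. \<forall>p\<le>i. ar s2 Degree p = ar s' Degree p - of_bool (p < j \<and> conflict s p q)"
  have deg: "?I (sc s1 Next) (exec (below PosP Next ?upd) s1)"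
  proof (rule below_rule[where I = ?I])
    fix j s2
    assume j: "j < sc s1 Next"
      and inv: "\<forall>p\<le>i. ar s2 Degree p = ar s' Degree p - of_bool (p < j \<and> conflict s p q)"
      and fr: "frame ?upd {PosP} s1 s2"
    define s3 where "s3 = set_var PosP j s2"
    have sc3: "sc s3 x = sc s x" if "x \<in> {Zero, Cur, Next, Size}" for x
      using fr sc1[OF that] that by (auto simp: frame_def s3_def)
    have ar3: "ar s3 a = ar s a" if "a \<in> {Label, Adjacent, Marking}" for a
      using fr ar1[OF that] that by (auto simp: frame_def s3_def)
    have q3: "sc s3 PosQ = q" "sc s3 PosP = j" "ar s3 Degree = ar s2 Degree"
      using fr s1 by (auto simp: frame_def s3_def)
    have ji: "j \<le> i" using j sc1[of Next] Next by simp
    have "sortable s3" using assms(1) sc3 ar3 sortable_cong[of s3 s] by blast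
    moreover have "conflict s3 = conflict s" using sc3 ar3 by (intro conflict_cong) auto
    ultimately have Bad: "sc (exec conflict_test s3) Bad = of_bool (conflict s j q)"
      using conflict_test_Bad[of s3] q3 q ji sc3[of Cur] by (simp add: i_def)
    have "sc (exec conflict_test s3) Zero = 0" "sc (exec conflict_test s3) PosP = j"
      "ar (exec conflict_test s3) = ar s3"
      using sc3[of Zero] Next q3 by (simp_all add: exec_var exec_arrs)
    then have "ar (exec ?upd s3) Degree = (if conflict s j q then (ar s2 Degree)(j := ar s2 Degree j - 1) else ar s2 Degree)"
      using Bad q3 by simp
    then show "\<forall>p\<le>i. ar (exec ?upd (set_var PosP j s2)) Degree p =
        ar s' Degree p - of_bool (p < Suc j \<and> conflict s p q)"
      using inv by (auto simp: s3_def[symmetric] less_Suc_eq)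
  qed (use s1 sc1 Next in auto)
  have fr: "ar (exec remove_next s') a = ar s1 a" if "a \<in> {Removed, New_Vertex, New_Label}" for a
    unfolding run using that by (intro exec_arr) auto
  define \<sigma>' where "\<sigma>' = \<sigma>(r := q)"
  have img: "\<sigma>' ` {..<Suc r} = insert q T" by (auto simp: \<sigma>'_def T_def lessThan_Suc)
  have img': "\<sigma>' ` {..a} = \<sigma> ` {..a}" if "a < r" for a
    using that by (auto simp: \<sigma>'_def)
  have "sorted_upto s (Suc r) \<sigma>' (exec remove_next s')"
    unfolding sorted_upto_def img i_def[symmetric]
  proof (intro conjI allI impI)
    show "inj_on \<sigma>' {..<Suc r}"
      using inv(1) q(2) by (auto simp: \<sigma>'_def lessThan_Suc T_def inj_on_def)
    show "insert q T \<subseteq> {..i}" using inv(2) q by auto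
  next
    fix p assume p: "p \<le> i"
    show "ar (exec remove_next s') Removed p = of_bool (p \<in> insert q T)"
      using inv(3)[OF p] by (simp add: fr s1)
    have "ar (exec remove_next s') Degree p = ar s' Degree p - of_bool (conflict s p q)"
      using deg p sc1[of Next] Next by (simp add: run less_Suc_eq_le)
    also have "\<dots> = card ({q'. q' \<le> i \<and> q' \<notin> T \<and> conflict s p q'} - {q})"
      using inv(4)[OF p] q by (simp add: card_Diff_singleton_if)
    also have "{q'. q' \<le> i \<and> q' \<notin> T \<and> conflict s p q'} - {q} =
        {q'. q' \<le> i \<and> q' \<notin> insert q T \<and> conflict s p q'}" by auto
    finally show "ar (exec remove_next s') Degree p =
        card {q'. q' \<le> i \<and> q' \<notin> insert q T \<and> conflict s p q'}" .
  next
    fix a assume "a < Suc r"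
    then show "ar (exec remove_next s') New_Vertex a = ar s Vertex (\<sigma>' a)"
      "ar (exec remove_next s') New_Label a = ar s Marking (\<sigma>' a)"
      using inv(5)[of a] by (auto simp: fr s1 \<sigma>'_def less_Suc_eq)
  next
    fix a q' assume *: "a < Suc r" "q' \<le> i" "q' \<notin> \<sigma>' ` {..a}"
    show "\<not> conflict s (\<sigma>' a) q'"
    proof (cases "a < r")
      case True
      then show ?thesis using inv(6)[OF True *(2)] *(3) img'[OF True] by (simp add: \<sigma>'_def)
    next
      case False
      then have "a = r" using * by simp
      moreover have "T \<subseteq> \<sigma>' ` {..r}" by (auto simp: T_def \<sigma>'_def)
      ultimately show ?thesis using * q_free[of q'] by (auto simp: \<sigma>'_def)
    qed
  qed
  then show ?thesis by blast
qed

definition copy_word :: com where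
  "copy_word = below PosP Next (Get Val New_Vertex PosP ;; Put Vertex PosP Val ;;
    Get Val New_Label PosP ;; Put Label PosP Val)"

definition sort_positions :: com where
  "sort_positions = count_conflicts ;; below Round Next remove_next ;; copy_word"

lemma sort_positions_syntax [simp]:
  "x \<notin> {PosP, PosQ, Round, Val, Count, Lab, Mark, Edge, Bad, Const_Tmp} \<Longrightarrow> x \<notin> mod_vars sort_positions"
  "input_free sort_positions" "wf_com sort_positions" "loop_depth sort_positions = 2"
  by (auto simp: sort_positions_def copy_word_def)

lemma copy_word:
  assumes "sc s Next \<le> sc s Size" "p < sc s Next"
  shows "ar (exec copy_word s) Vertex p = ar s New_Vertex p"
    and "ar (exec copy_word s) Label p = ar s New_Label p"
proof -
  let ?c = "Get Val New_Vertex PosP ;; Put Vertex PosP Val ;; Get Val New_Label PosP ;; Put Label PosP Val"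
  let ?I = "\<lambda>j s'. \<forall>p<j. ar s' Vertex p = ar s New_Vertex p \<and> ar s' Label p = ar s New_Label p"
  have "?I (sc s Next) (exec copy_word s)"
    unfolding copy_word_def
  proof (rule below_rule[where I = ?I])
    fix j s'
    assume "?I j s'" "frame ?c {PosP} s s'"
    then show "?I (Suc j) (exec ?c (set_var PosP j s'))"
      by (auto simp: frame_def less_Suc_eq)
  qed (use assms in auto)
  then show "ar (exec copy_word s) Vertex p = ar s New_Vertex p"
    "ar (exec copy_word s) Label p = ar s New_Label p"
    using assms(2) by auto
qed

lemma sort_positions:
  assumes "sortable s" and rep: "represents D A (pos_edge A (sc s Cur) (ar s Label) (ar s Adjacent))
      {..sc s Cur} (ar s Marking) rk"
  obtains \<sigma> where "bij_betw \<sigma> {..sc s Cur} {..sc s Cur}"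
    "\<And>a. a \<le> sc s Cur \<Longrightarrow> ar (exec sort_positions s) Vertex a = ar s Vertex (\<sigma> a)"
    "\<And>a. a \<le> sc s Cur \<Longrightarrow> ar (exec sort_positions s) Label a = ar s Marking (\<sigma> a)"
    "\<And>a b. a < b \<Longrightarrow> b \<le> sc s Cur \<Longrightarrow>
      pos_edge A (sc s Cur) (ar s Label) (ar s Adjacent) (\<sigma> a) (\<sigma> b) \<longleftrightarrow>
      A (ar s Marking (\<sigma> a)) (ar s Marking (\<sigma> b))"
proof -
  define i where "i = sc s Cur"
  have Next: "sc s Next = Suc i" "sc s Next \<le> sc s Size"
    using assms(1) by (auto simp: sortable_def ready_def i_def)
  define s1 where "s1 = exec count_conflicts s"
  define s2 where "s2 = exec (below Round Next remove_next) s1"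
  have sc1: "sc s1 x = sc s x" if "x \<in> {Zero, Cur, Next, Size}" for x
    unfolding s1_def using that by (intro exec_var) auto
  have ar1: "ar s1 a = ar s a" if "a \<in> {Label, Adjacent, Marking, Vertex}" for a
    unfolding s1_def using that by (intro exec_arr) auto
  let ?I = "\<lambda>r s'. \<exists>\<sigma>. sorted_upto s r \<sigma> s'"
  have "?I (sc s1 Next) s2"
    unfolding s2_def
  proof (rule below_rule[where I = ?I])
    show "?I 0 s1"
      using count_conflicts[OF assms(1)] by (simp add: sorted_upto_def s1_def)
    show "?I (sc s1 Next) (set_var Round v s')" if "?I (sc s1 Next) s'" for v s'
      using that by (simp add: sorted_upto_def)
    fix r s'
    assume r: "r < sc s1 Next" and inv: "?I r s'" and fr: "frame remove_next {Round} s1 s'"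
    from inv obtain \<sigma> where \<sigma>: "sorted_upto s r \<sigma> (set_var Round r s')"
      by (auto simp: sorted_upto_def)
    show "?I (Suc r) (exec remove_next (set_var Round r s'))"
    proof (rule remove_next[OF assms _ _ _ _ \<sigma>])
      show "sc (set_var Round r s') x = sc s x" if "x \<in> {Zero, Cur, Next, Size}" for x
        using fr sc1[OF that] that by (auto simp: frame_def)
      show "ar (set_var Round r s') a = ar s a" if "a \<in> {Label, Adjacent, Marking, Vertex}" for a
        using fr ar1[OF that] that by (auto simp: frame_def)
    qed (use r sc1 in auto)
  qed (use Next sc1 in auto)
  then obtain \<sigma> where "sorted_upto s (Suc i) \<sigma> s2"
    using sc1[of Next] Next by auto
  then have \<sigma>: "inj_on \<sigma> {..i}" "\<sigma> ` {..i} \<subseteq> {..i}"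
    "\<And>a. a \<le> i \<Longrightarrow> ar s2 New_Vertex a = ar s Vertex (\<sigma> a)"
    "\<And>a. a \<le> i \<Longrightarrow> ar s2 New_Label a = ar s Marking (\<sigma> a)"
    "\<And>a q. a \<le> i \<Longrightarrow> q \<le> i \<Longrightarrow> q \<notin> \<sigma> ` {..a} \<Longrightarrow> \<not> conflict s (\<sigma> a) q"
    by (auto simp: sorted_upto_def lessThan_Suc_atMost i_def less_Suc_eq_le)
  have sc2: "sc s2 Next = Suc i" "sc s2 Next \<le> sc s2 Size"
    using sc1[of Next] sc1[of Size] Next by (auto simp: s2_def exec_var)
  have run: "exec sort_positions s = exec copy_word s2"
    by (simp add: sort_positions_def s1_def s2_def)
  show thesis
  proof (rule that[of \<sigma>, folded i_def])
    have "\<sigma> ` {..i} = {..i}" using \<sigma>(1,2) by (intro endo_inj_surj) auto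
    then show "bij_betw \<sigma> {..i} {..i}" using \<sigma>(1) by (simp add: bij_betw_def)
    show "ar (exec sort_positions s) Vertex a = ar s Vertex (\<sigma> a)"
      "ar (exec sort_positions s) Label a = ar s Marking (\<sigma> a)" if "a \<le> i" for a
      unfolding run using copy_word[of s2 a] sc2 \<sigma>(3,4) that by auto
    fix a b assume ab: "a < b" "b \<le> i"
    then have "\<sigma> b \<notin> \<sigma> ` {..a}" using \<sigma>(1) by (auto dest: inj_onD)
    then have "\<not> conflict s (\<sigma> a) (\<sigma> b)" using \<sigma>(2,5) ab by auto
    moreover have "\<sigma> a \<noteq> \<sigma> b" using \<sigma>(1) ab by (auto dest: inj_onD)
    ultimately show "pos_edge A i (ar s Label) (ar s Adjacent) (\<sigma> a) (\<sigma> b) \<longleftrightarrow>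
        A (ar s Marking (\<sigma> a)) (ar s Marking (\<sigma> b))"
      by (simp add: conflict_def i_def)
  qed
qed

definition read_row :: com where
  "read_row = For Scan (Input Val ;; Put Row Scan Val)"

lemma read_row:
  assumes "inp s = row @ rest" "length row = sc s Size"
  shows "inp (exec read_row s) = rest"
    and "\<And>u. u < sc s Size \<Longrightarrow> ar (exec read_row s) Row u = row ! u"
proof -
  let ?c = "Input Val ;; Put Row Scan Val"
  let ?I = "\<lambda>j s'. inp s' = drop j row @ rest \<and> (\<forall>u<j. ar s' Row u = row ! u)"
  have "?I (sc s Size) (exec read_row s)"
    unfolding read_row_def
  proof (rule For_rule[where I = ?I])
    fix j and s' :: store
    assume j: "j < sc s Size" and inv: "?I j s'"
    then have "inp s' = row ! j # (drop (Suc j) row @ rest)"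
      using assms(2) by (simp add: Cons_nth_drop_Suc[symmetric])
    then show "?I (Suc j) (exec ?c (set_var Scan j s'))"
      using inv by (auto simp: less_Suc_eq)
  qed (use assms in auto)
  then show "inp (exec read_row s) = rest" "\<And>u. u < sc s Size \<Longrightarrow> ar (exec read_row s) Row u = row ! u"
    using assms by auto
qed

lemma read_row_syntax [simp]:
  "mod_vars read_row = {Scan, Val}" "mod_arrs read_row = {Row}" "wf_com read_row"
  "loop_depth read_row = 1"
  by (auto simp: read_row_def)

definition load_neighbours :: com where
  "load_neighbours = below PosP Cur (Get Val Vertex PosP ;; Get Val Row Val ;; Put Adjacent PosP Val)"

lemma load_neighbours:
  assumes "sc s Cur \<le> sc s Size" "p < sc s Cur"
  shows "ar (exec load_neighbours s) Adjacent p = ar s Row (ar s Vertex p)"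
proof -
  let ?c = "Get Val Vertex PosP ;; Get Val Row Val ;; Put Adjacent PosP Val"
  let ?I = "\<lambda>j s'. \<forall>p<j. ar s' Adjacent p = ar s Row (ar s Vertex p)"
  have "?I (sc s Cur) (exec load_neighbours s)"
    unfolding load_neighbours_def
  proof (rule below_rule[where I = ?I])
    fix j s'
    assume "?I j s'" "frame ?c {PosP} s s'"
    then show "?I (Suc j) (exec ?c (set_var PosP j s'))"
      by (auto simp: frame_def less_Suc_eq)
  qed (use assms in auto)
  then show ?thesis using assms(2) by blast
qed

lemma load_neighbours_syntax [simp]:
  "mod_vars load_neighbours = {PosP, Val}" "mod_arrs load_neighbours = {Adjacent}"
  "input_free load_neighbours" "wf_com load_neighbours" "loop_depth load_neighbours = 1"
  by (auto simp: load_neighbours_def)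

definition clear_marks :: com where
  "clear_marks = Const Val D ;; below PosP Next (Put Marking PosP Val)"

lemma clear_marks:
  assumes "sc s Next \<le> sc s Size" "p < sc s Next"
  shows "ar (exec clear_marks s) Marking p = D"
proof -
  let ?c = "Put Marking PosP Val" and ?s = "set_var Val D s"
  let ?I = "\<lambda>j s'. \<forall>p<j. ar s' Marking p = D"
  have "?I (sc ?s Next) (exec (below PosP Next ?c) ?s)"
  proof (rule below_rule[where I = ?I])
    fix j s'
    assume "?I j s'" "frame ?c {PosP} ?s s'"
    then show "?I (Suc j) (exec ?c (set_var PosP j s'))"
      by (auto simp: frame_def less_Suc_eq)
  qed (use assms in auto)
  then show ?thesis using assms(2) by (simp add: clear_marks_def)
qed

lemma clear_marks_syntax [simp]:
  "mod_vars clear_marks = {PosP, Val}" "mod_arrs clear_marks = {Marking}"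
  "input_free clear_marks" "wf_com clear_marks" "loop_depth clear_marks = 1"
  by (auto simp: clear_marks_def)

definition insert_vertex :: com where
  "insert_vertex = (Copy Next Cur ;; Inc Next) ;; read_row ;; load_neighbours ;; clear_marks ;;
    mark_all ;; IfPos Fail SKIP (Put Vertex Cur Cur ;; sort_positions)"

lemma insert_vertex_syntax [simp]:
  "x \<in> {Out, Size, Zero, Cur} \<Longrightarrow> x \<notin> mod_vars insert_vertex"
  "wf_com insert_vertex" "loop_depth insert_vertex \<le> 2"
  by (auto simp: insert_vertex_def)

definition word_of :: "(nat \<Rightarrow> nat \<Rightarrow> bool) \<Rightarrow> nat \<Rightarrow> store \<Rightarrow> bool" where
  "word_of E i s \<longleftrightarrow> bij_betw (ar s Vertex) {..<i} {..<i} \<and> (\<forall>p<i. ar s Label p < D) \<and>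
    (\<forall>p q. p < q \<longrightarrow> q < i \<longrightarrow>
      (E (ar s Vertex p) (ar s Vertex q) \<longleftrightarrow> A (ar s Label p) (ar s Label q)))"

lemma insert_vertex:
  fixes E :: "nat \<Rightarrow> nat \<Rightarrow> bool"
  assumes sym: "\<And>u v. E u v \<longleftrightarrow> E v u"
    and s: "sc s Zero = 0" "sc s Fail = 0" "sc s Cur < sc s Size" "word_of E (sc s Cur) s"
    and inp: "inp s = map (\<lambda>v. of_bool (E (sc s Cur) v)) [0..<sc s Size] @ rest"
  defines "s' \<equiv> exec insert_vertex s"
  shows "sc s' Fail = 0 \<and> inp s' = rest \<and> word_of E (Suc (sc s Cur)) s' \<or>
    sc s' Fail = 1 \<and> \<not> letter_graph D A E {..sc s Cur}"
proof -
  define i n where "i = sc s Cur" and "n = sc s Size"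
  have i: "i < n" using s by (simp add: i_def n_def)
  define V where "V = (ar s Vertex)(i := i)"
  have wd: "bij_betw (ar s Vertex) {..<i} {..<i}" "\<And>p. p < i \<Longrightarrow> ar s Label p < D"
    "\<And>p q. p < q \<Longrightarrow> q < i \<Longrightarrow> E (ar s Vertex p) (ar s Vertex q) \<longleftrightarrow> A (ar s Label p) (ar s Label q)"
    using s(4) by (auto simp: word_of_def i_def)
  have V_bij: "bij_betw V {..i} {..i}"
  proof -
    have "bij_betw V {..<i} {..<i}"
      using wd(1) by (rule bij_betw_cong[THEN iffD1, rotated]) (simp add: V_def)
    then have "bij_betw V ({..<i} \<union> {i}) ({..<i} \<union> {V i})"
      by (intro notIn_Un_bij_betw) (auto simp: V_def)
    then show ?thesis by (simp add: V_def lessThan_Suc_atMost[symmetric] lessThan_Suc)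
  qed
  define s1 where "s1 = exec (Copy Next Cur ;; Inc Next) s"
  define s2 where "s2 = exec read_row s1"
  define s3 where "s3 = exec load_neighbours s2"
  define s4 where "s4 = exec clear_marks s3"
  define s5 where "s5 = exec mark_all s4"
  have run: "s' = exec (IfPos Fail SKIP (Put Vertex Cur Cur ;; sort_positions)) s5"
    by (simp add: s'_def insert_vertex_def s1_def s2_def s3_def s4_def s5_def)
  have sc1: "sc s1 Next = Suc i" "sc s1 Zero = 0" "sc s1 Cur = i" "sc s1 Size = n" "sc s1 Fail = 0"
    "ar s1 = ar s" "inp s1 = inp s"
    using s i by (auto simp: s1_def i_def n_def)
  have sc2: "sc s2 Next = Suc i" "sc s2 Zero = 0" "sc s2 Cur = i" "sc s2 Size = n" "sc s2 Fail = 0"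
    using sc1 by (auto simp: s2_def exec_var)
  have ar2: "ar s2 a = ar s a" if "a \<noteq> Row" for a
    using that sc1 by (auto simp: s2_def exec_arr)
  have row: "inp s2 = rest" "\<And>u. u < n \<Longrightarrow> ar s2 Row u = of_bool (E i u)"
    using read_row[of s1 "map (\<lambda>v. of_bool (E i v)) [0..<n]" rest] sc1 inp
    by (auto simp: s2_def i_def n_def)
  have sc3: "sc s3 Next = Suc i" "sc s3 Zero = 0" "sc s3 Cur = i" "sc s3 Size = n" "sc s3 Fail = 0"
    using sc2 by (auto simp: s3_def exec_var)
  have ar3: "ar s3 a = ar s a" if "a \<noteq> Row" "a \<noteq> Adjacent" for a
    using that ar2 by (auto simp: s3_def exec_arr)
  have adj3: "ar s3 Adjacent p = of_bool (E i (V p))" if "p < i" for p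
  proof -
    have "ar s Vertex p < i" using bij_betwE[OF wd(1)] that by (meson lessThan_iff)
    then have "ar s Vertex p < n" using i by simp
    then show ?thesis
      using load_neighbours[of s2 p] that sc2 i row(2) ar2[of Vertex] by (simp add: s3_def V_def)
  qed
  have sc4: "sc s4 Next = Suc i" "sc s4 Zero = 0" "sc s4 Cur = i" "sc s4 Size = n" "sc s4 Fail = 0"
    using sc3 by (auto simp: s4_def exec_var)
  have ar4: "ar s4 a = ar s3 a" if "a \<noteq> Marking" for a
    unfolding s4_def using that by (intro exec_arr) simp
  have mark4: "ar s4 Marking p = D" if "p \<le> i" for p
    unfolding s4_def using clear_marks[of s3 p] that sc3 i by simp
  have ready4: "ready s4"
    using sc4 i wd(2) ar4 ar3[of Label] adj3 by (auto simp: ready_def)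
  let ?E = "pos_edge A i (ar s4 Label) (ar s4 Adjacent)"
  have pos_edge: "?E p q \<longleftrightarrow> E (V p) (V q)" if "p \<le> i" "q \<le> i" "p \<noteq> q" for p q
  proof -
    have *: "?E p q \<longleftrightarrow> E (V p) (V q)" if "p < q" "q \<le> i" for p q
    proof (cases "q < i")
      case True
      then show ?thesis
        using that wd(3)[of p q] ar4 ar3[of Label] by (simp add: pos_edge_def V_def min_def max_def)
    next
      case False
      then have "q = i" using that by simp
      then show ?thesis
        using that ar4 adj3[of p] sym[of i] by (simp add: pos_edge_def V_def min_def max_def)
    qed
    have "?E p q \<longleftrightarrow> ?E q p" by (simp add: pos_edge_def min.commute max.commute)
    then show ?thesis using *[of p q] *[of q p] that sym[of "V p" "V q"] by (cases "p < q") auto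
  qed
  have lg: "letter_graph D A ?E {..i} \<longleftrightarrow> letter_graph D A E {..i}"
    by (rule letter_graph_bij[OF V_bij]) (use pos_edge in auto)
  have unmarked: "ext s4 (ar s4 Marking) \<longleftrightarrow> letter_graph D A E {..i}"
    using extendable_unmarked[of i D "ar s4 Marking"] mark4 lg sc4 by simp
  have sc5: "sc s5 Next = Suc i" "sc s5 Zero = 0" "sc s5 Cur = i" "sc s5 Size = n"
    using sc4 by (auto simp: s5_def exec_var)
  have ar5: "ar s5 a = ar s4 a" if "a \<noteq> Marking" for a
    unfolding s5_def using that by (intro exec_arr) simp
  have inp5: "inp s5 = rest"
    using row(1) by (simp add: s5_def s4_def s3_def exec_inp)
  from mark_all_Fail[OF ready4 sc4(5)] mark4 sc4(3)
  consider (ok) "sc s5 Fail = 0" "\<And>p. p \<le> i \<Longrightarrow> ar s5 Marking p < D" "ext s4 (ar s5 Marking)"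
    | (fail) "sc s5 Fail = 1" "\<not> ext s4 (ar s4 Marking)"
    by (auto simp: s5_def)
  then show ?thesis
  proof cases
    case fail
    then show ?thesis using run sc5 unmarked by (simp add: i_def)
  next
    case ok
    define s6 where "s6 = exec (Put Vertex Cur Cur) s5"
    have run: "s' = exec sort_positions s6" using run ok(1) sc5 by (simp add: s6_def)
    have ar6: "ar s6 Label = ar s4 Label" "ar s6 Adjacent = ar s4 Adjacent"
      "ar s6 Marking = ar s5 Marking" "ar s6 Vertex = V"
      using sc5 ar5 ar4[of Vertex] ar3[of Vertex] by (simp_all add: s6_def V_def)
    have sc6: "sc s6 = sc s5" "inp s6 = rest" using inp5 by (simp_all add: s6_def)
    from ok(3) ok(2) sc4(3) obtain rk where
      "represents D A ?E {..i} (ar s5 Marking) rk"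
      using extendable_marked[of D A i "ar s4 Label" "ar s4 Adjacent" "ar s5 Marking"] by auto
    then have rep: "represents D A (pos_edge A (sc s6 Cur) (ar s6 Label) (ar s6 Adjacent))
        {..sc s6 Cur} (ar s6 Marking) rk"
      using ar6 sc6 sc5 by simp
    have "ready s6"
      using ready4 sc4 sc5 by (simp add: ready_def ar6 sc6)
    then have "sortable s6" using ok(2) sc5 by (simp add: sortable_def ar6 sc6)
    from sort_positions[OF this rep] obtain \<sigma> where \<sigma>: "bij_betw \<sigma> {..i} {..i}"
      "\<And>a. a \<le> i \<Longrightarrow> ar s' Vertex a = V (\<sigma> a)"
      "\<And>a. a \<le> i \<Longrightarrow> ar s' Label a = ar s5 Marking (\<sigma> a)"
      "\<And>a b. a < b \<Longrightarrow> b \<le> i \<Longrightarrow> ?E (\<sigma> a) (\<sigma> b) \<longleftrightarrow> A (ar s5 Marking (\<sigma> a)) (ar s5 Marking (\<sigma> b))"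
      unfolding run[symmetric] using ar6 sc6 sc5 by auto
    have \<sigma>_le: "\<sigma> a \<le> i" if "a \<le> i" for a using \<sigma>(1) that by (auto dest: bij_betwE)
    have "word_of E (Suc i) s'"
      unfolding word_of_def lessThan_Suc_atMost
    proof (intro conjI allI impI)
      have "bij_betw (V \<circ> \<sigma>) {..i} {..i}" using \<sigma>(1) V_bij by (rule bij_betw_trans)
      then show "bij_betw (ar s' Vertex) {..i} {..i}"
        by (rule bij_betw_cong[THEN iffD1, rotated]) (simp add: \<sigma>)
      show "ar s' Label p < D" if "p < Suc i" for p
        using that \<sigma>(3) \<sigma>_le ok(2) by simp
      fix p q assume pq: "p < q" "q < Suc i"
      then have "\<sigma> p \<noteq> \<sigma> q" using \<sigma>(1) by (auto simp: bij_betw_def dest: inj_onD)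
      then show "E (ar s' Vertex p) (ar s' Vertex q) \<longleftrightarrow> A (ar s' Label p) (ar s' Label q)"
        using \<sigma>(2-4) pos_edge[of "\<sigma> p" "\<sigma> q"] \<sigma>_le pq by simp
    qed
    moreover have "sc s' Fail = 0" "inp s' = rest"
      using run ok(1) sc6 by (simp_all add: exec_var exec_inp)
    ultimately show ?thesis by (simp add: i_def)
  qed
qed

definition recognise :: com where
  "recognise = For Cur (IfPos Fail SKIP insert_vertex) ;; IfPos Fail (Const Out 0) (Const Out 1)"

lemma recognise_syntax: "wf_com recognise" "loop_depth recognise \<le> 3"
  by (auto simp: recognise_def)

theorem recognise:
  fixes E :: "nat \<Rightarrow> nat \<Rightarrow> bool"
  assumes sym: "\<And>u v. E u v \<longleftrightarrow> E v u"
    and s: "sc s Zero = 0" "sc s Fail = 0" "sc s Size = n"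
    and inp: "inp s = concat (map (\<lambda>u. map (\<lambda>v. of_bool (E u v)) [0..<n]) [0..<n])"
  shows "sc (exec recognise s) Out = of_bool (letter_graph D A E {..<n})"
proof -
  let ?row = "\<lambda>u. map (\<lambda>v. of_bool (E u v)) [0..<n]"
  let ?c = "IfPos Fail SKIP insert_vertex"
  let ?I = "\<lambda>i s'. sc s' Fail = 0 \<and> inp s' = concat (map ?row [i..<n]) \<and> word_of E i s' \<or>
    sc s' Fail = 1 \<and> \<not> letter_graph D A E {..<n}"
  define s1 where "s1 = exec (For Cur ?c) s"
  have "?I (sc s Size) s1"
    unfolding s1_def
  proof (rule For_rule[where I = ?I])
    show "?I 0 s" using s inp by (simp add: word_of_def bij_betw_def)
    show "?I (sc s Size) (set_var Cur v s')" if "?I (sc s Size) s'" for s' v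
      using that by (simp add: word_of_def)
    fix i s'
    assume i: "i < sc s Size" and inv: "?I i s'" and fr: "frame ?c {Cur} s s'"
    have sc: "sc s' Zero = 0" "sc s' Size = n" using fr s by (auto simp: frame_def)
    show "?I (Suc i) (exec ?c (set_var Cur i s'))"
    proof (cases "sc s' Fail = 0")
      case True
      define s2 where "s2 = set_var Cur i s'"
      have s2: "sc s2 Zero = 0" "sc s2 Fail = 0" "sc s2 Cur = i" "sc s2 Size = n" "word_of E i s2"
        "inp s2 = ?row i @ concat (map ?row [Suc i..<n])"
        using inv sc True i s by (auto simp: s2_def word_of_def upt_conv_Cons)
      have "sc (exec insert_vertex s2) Fail = 0 \<and>
          inp (exec insert_vertex s2) = concat (map ?row [Suc i..<n]) \<and>
          word_of E (Suc i) (exec insert_vertex s2) \<or>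
        sc (exec insert_vertex s2) Fail = 1 \<and> \<not> letter_graph D A E {..i}"
        using insert_vertex[where s = s2 and rest = "concat (map ?row [Suc i..<n])", OF sym] s2 i s by simp
      moreover have "\<not> letter_graph D A E {..<n}" if "\<not> letter_graph D A E {..i}"
      proof -
        have "{..i} \<subseteq> {..<n}" using i s(3) by auto
        then show ?thesis using that letter_graph_subset by blast
      qed
      moreover have "exec ?c s2 = exec insert_vertex s2" using s2 by simp
      ultimately show ?thesis unfolding s2_def by auto
    next
      case False
      then show ?thesis using inv sc by auto
    qed
  qed
  moreover have "letter_graph D A E {..<n}" if "word_of E n s1"
  proof -
    let ?V = "ar s1 Vertex" and ?L = "ar s1 Label"
    have "represents D A (\<lambda>p q. E (?V p) (?V q)) {..<n} ?L id"
      using that by (auto simp: represents_def word_of_def)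
    then have "letter_graph D A (\<lambda>p q. E (?V p) (?V q)) {..<n}" by (auto simp: letter_graph_def)
    then show ?thesis
      using letter_graph_bij[of ?V "{..<n}" "{..<n}" "\<lambda>p q. E (?V p) (?V q)" E] that
      by (auto simp: word_of_def)
  qed
  moreover have "sc s1 Zero = 0"
    using s exec_var[of Zero "For Cur ?c" s] by (simp add: s1_def del: exec.simps)
  moreover have "exec recognise s = exec (IfPos Fail (Const Out 0) (Const Out 1)) s1"
    by (simp only: recognise_def exec.simps(9) s1_def)
  ultimately show ?thesis using s by auto
qed

end

section \<open>The recognition algorithm as a machine\<close>

definition machine :: "com \<Rightarrow> ram_program" where
  "machine c = Read (var_addr Size) # compile c 1"

definition initial_store :: "nat \<Rightarrow> nat list \<Rightarrow> store" where
  "initial_store n xs = \<lparr>inp = xs, sc = (\<lambda>_. 0)(Size := n), ar = \<lambda>_ _. 0\<rparr>"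

lemma ram_step_halted: "halted prog s \<Longrightarrow> (ram_step prog ^^ t) s = s"
  by (induction t) (auto simp: ram_step_def)

lemma machine_correct:
  assumes "wf_com c" "max_const c \<le> B" "n \<le> B" "\<And>x. x \<in> set xs \<Longrightarrow> x \<le> B"
  obtains t where "t \<le> Suc (run_time c n)" "halted (machine c) (ram_run (machine c) (n # xs) t)"
    "registers (ram_run (machine c) (n # xs) t) 0 = sc (exec c (initial_store n xs)) Out"
    "\<And>u a. registers (ram_run (machine c) (n # xs) u) a \<le> 41 + 9 * B"
proof -
  let ?P = "machine c" and ?W = "41 + 9 * B" and ?s = "initial_store n xs"
  let ?R = "(\<lambda>_. 0)(var_addr Size := n)"
  have start: "reach ?P ?W 1 (0, n # xs, \<lambda>_. 0) (1, inp ?s, ?R)"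
    using assms(3) by (auto simp: machine_def initial_store_def intro!: reach_step reach_refl)
  have code: "code_at ?P 1 (compile c 1)"
    by (simp add: machine_def code_at_def)
  have rel: "store_rel ?W ?s ?R"
    using assms(3) by (auto simp: store_rel_def initial_store_def)
  have "bounded_store B ?s"
    using assms(3,4) by (auto simp: bounded_store_def initial_store_def)
  from simulatedD[OF compile_correct[OF order_refl assms(1,2)] code rel this]
  obtain t R' where t: "t \<le> run_time c (sc ?s Size)" "store_rel ?W (exec c ?s) R'"
    "reach ?P ?W t (1, inp ?s, ?R) (1 + code_length c, inp (exec c ?s), R')" .
  have reach: "reach ?P ?W (1 + t) (0, n # xs, \<lambda>_. 0) (1 + code_length c, inp (exec c ?s), R')"
    by (rule reach_trans[OF start t(3)])
  have run: "ram_run ?P (n # xs) (1 + t) = (1 + code_length c, inp (exec c ?s), R')"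
    using reach by (simp add: reach_def ram_run_def)
  have halt: "halted ?P (ram_run ?P (n # xs) (1 + t))"
    unfolding run by (simp add: machine_def)
  have "ram_run ?P (n # xs) u = ram_run ?P (n # xs) (1 + t)" if "1 + t \<le> u" for u
  proof -
    have "ram_run ?P (n # xs) (u - (1 + t) + (1 + t)) = ram_run ?P (n # xs) (1 + t)"
      unfolding ram_run_def funpow_add o_apply
      by (rule ram_step_halted) (use halt in \<open>simp add: ram_run_def\<close>)
    then show ?thesis using that by simp
  qed
  then have "registers (ram_run ?P (n # xs) u) a \<le> ?W" for u a
    using reach unfolding reach_def ram_run_def by (metis nat_le_linear order_refl)
  moreover have "registers (ram_run ?P (n # xs) (1 + t)) 0 = sc (exec c ?s) Out"
    unfolding run using t(2) by (simp add: store_rel_def var_addr.simps(1)[symmetric])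
  moreover have "1 + t \<le> Suc (run_time c n)" using t(1) by (simp add: initial_store_def)
  ultimately show thesis using halt that by blast
qed

lemma cubic_bigo:
  assumes "\<And>n. f n \<le> Suc (C * (n + 1) ^ d)" "d \<le> 3"
  shows "(\<lambda>n. real (f n)) \<in> O(\<lambda>n. real n ^ 3)"
proof (rule bigoI)
  show "\<forall>\<^sub>F n in sequentially. norm (real (f n)) \<le> real (1 + 8 * C) * norm (real n ^ 3)"
    using eventually_ge_at_top[of 1]
  proof eventually_elim
    fix n :: nat
    assume n: "1 \<le> n"
    have "(n + 1) ^ d \<le> (n + 1) ^ 3" using assms(2) by (intro power_increasing) auto
    also have "\<dots> \<le> (2 * n) ^ 3" using n by (intro power_mono) auto
    finally have "C * (n + 1) ^ d \<le> C * (8 * n ^ 3)" by (simp add: power_mult_distrib)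
    moreover have "1 \<le> n ^ 3" using n by simp
    moreover have "(1 + 8 * C) * n ^ 3 = n ^ 3 + C * (8 * n ^ 3)" by (simp add: add_mult_distrib)
    ultimately have "f n \<le> (1 + 8 * C) * n ^ 3"
      using assms(1)[of n] by linarith
    then have "real (f n) \<le> real ((1 + 8 * C) * n ^ 3)" by (rule of_nat_mono)
    then show "norm (real (f n)) \<le> real (1 + 8 * C) * norm (real n ^ 3)"
      by (simp add: distrib_right)
  qed
qed

lemma linear_bigo: "(\<lambda>n. real (a + b * n)) \<in> O(\<lambda>n. real n ^ 1)"
proof (rule bigoI)
  show "\<forall>\<^sub>F n in sequentially. norm (real (a + b * n)) \<le> real (a + b) * norm (real n ^ 1)"
    using eventually_ge_at_top[of 1]
  proof eventually_elim
    fix n :: nat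
    assume "1 \<le> n"
    then have "a + b * n \<le> (a + b) * n" by (simp add: add_mult_distrib)
    then have "real (a + b * n) \<le> real ((a + b) * n)" by (rule of_nat_mono)
    then show "norm (real (a + b * n)) \<le> real (a + b) * norm (real n ^ 1)" by simp
  qed
qed

theorem letter_graph_machine:
  fixes D :: nat and A :: "nat \<Rightarrow> nat \<Rightarrow> bool"
  obtains prog where "ram_decides prog (\<lambda>G. letter_graph D A (\<lambda>u v. (u, v) \<in> parcs G) (pverts G))"
    and "ram_time prog (\<lambda>n. real n ^ 3)" "ram_log_words prog"
proof -
  let ?X = "{..<D} \<times> {..<2::nat} \<times> {..D}"
  have closed: "word_extendable D A x u" if "x \<in> {..D}" "subseq u w" "word_extendable D A x w" for x u w
    using that(2,3) by (rule word_extendable_subseq)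
  have finite: "finite ?X" "finite {..D}" by auto
  obtain m q0 :: nat and \<delta> :: "nat \<Rightarrow> nat \<times> nat \<times> nat \<Rightarrow> nat" and acc :: "nat \<Rightarrow> nat \<Rightarrow> bool"
    where "q0 < m" "\<And>q a. q < m \<Longrightarrow> \<delta> q a < m"
    and "\<And>x w. x \<in> {..D} \<Longrightarrow> w \<in> lists ?X \<Longrightarrow> acc (foldl \<delta> q0 w) x \<longleftrightarrow> word_extendable D A x w"
    by (rule subseq_closed_automaton[where L = "word_extendable D A", OF finite closed]) blast+
  then interpret recogniser D A m q0 \<delta> acc
    by unfold_locales auto
  obtain C where C: "\<And>n. run_time recognise n \<le> C * (n + 1) ^ loop_depth recognise"
    using run_time_bound by blast
  define K where "K = max_const recognise"
  have run: "\<exists>t. t \<le> Suc (run_time recognise n) \<and>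
      halted (machine recognise) (ram_run (machine recognise) (graph_input n G) t) \<and>
      registers (ram_run (machine recognise) (graph_input n G) t) 0 =
        of_bool (letter_graph D A (\<lambda>u v. (u, v) \<in> parcs G) (pverts G)) \<and>
      (\<forall>u a. registers (ram_run (machine recognise) (graph_input n G) u) a \<le> 41 + 9 * (n + 1 + K))"
    if G: "input_graph n G" for n G
  proof -
    let ?E = "\<lambda>u v. (u, v) \<in> parcs G"
    let ?xs = "concat (map (\<lambda>u. map (\<lambda>v. of_bool (?E u v)) [0..<n]) [0..<n])"
    have input: "graph_input n G = n # ?xs" by (simp add: graph_input_def)
    interpret pair_graph G using G by (simp add: input_graph_def)
    have "?E u v \<longleftrightarrow> ?E v u" for u v using arcs_symmetric by blast
    then have "sc (exec recognise (initial_store n ?xs)) Out = of_bool (letter_graph D A ?E {..<n})"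
      by (rule recognise) (simp_all add: initial_store_def)
    moreover have "pverts G = {..<n}" using G by (simp add: input_graph_def)
    moreover have B: "max_const recognise \<le> n + 1 + K" "n \<le> n + 1 + K"
      "\<And>x. x \<in> set ?xs \<Longrightarrow> x \<le> n + 1 + K"
      by (auto simp: K_def)
    obtain t where "t \<le> Suc (run_time recognise n)"
      "halted (machine recognise) (ram_run (machine recognise) (n # ?xs) t)"
      "registers (ram_run (machine recognise) (n # ?xs) t) 0 =
        sc (exec recognise (initial_store n ?xs)) Out"
      "\<And>u a. registers (ram_run (machine recognise) (n # ?xs) u) a \<le> 41 + 9 * (n + 1 + K)"
      using machine_correct[OF recognise_syntax(1) B] by blast
    ultimately show ?thesis
      unfolding input by (intro exI[of _ t]) simp
  qed
  show thesis
  proof (rule that[of "machine recognise"])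
    show "ram_decides (machine recognise) (\<lambda>G. letter_graph D A (\<lambda>u v. (u, v) \<in> parcs G) (pverts G))"
      unfolding ram_decides_def using run by blast
    have "(\<lambda>n. real (Suc (run_time recognise n))) \<in> O(\<lambda>n. real n ^ 3)"
      using C recognise_syntax(2) by (intro cubic_bigo) auto
    then show "ram_time (machine recognise) (\<lambda>n. real n ^ 3)"
      unfolding ram_time_def
      by (intro exI[of _ "\<lambda>n. Suc (run_time recognise n)"] conjI allI impI) (use run in blast)+
    have "registers (ram_run (machine recognise) (graph_input n G) t) a \<le> 50 + 9 * K + 9 * n"
      if "input_graph n G" for n G t a
    proof -
      have "registers (ram_run (machine recognise) (graph_input n G) t) a \<le> 41 + 9 * (n + 1 + K)"
        using run[OF that] by blast
      then show ?thesis by simp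
    qed
    then show "ram_log_words (machine recognise)"
      unfolding ram_log_words_def
      by (intro exI[of _ "\<lambda>n. 50 + 9 * K + 9 * n"] exI[of _ 1] conjI allI impI linear_bigo) blast
  qed
qed

section \<open>Threshold graphs as letter graphs\<close>

text \<open>
  The letter of a vertex encodes its colour and the colour of the vertices after it in the
  elimination order to which it is adjacent, where \<open>0\<close> means that it is isolated.
\<close>

definition letter_colour :: "nat \<Rightarrow> nat \<Rightarrow> nat" where
  "letter_colour k a = Suc (a mod k)"

definition letter_target :: "nat \<Rightarrow> nat \<Rightarrow> nat" where
  "letter_target k a = a div k"

definition threshold_decoder :: "nat \<Rightarrow> nat \<Rightarrow> nat \<Rightarrow> bool" where
  "threshold_decoder k a b \<longleftrightarrow> letter_target k a = letter_colour k b"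

lemma neighbours_induced:
  "neighbours (with_proj G \<restriction> W) x = {y. x \<in> W \<and> y \<in> W \<and> (x, y) \<in> parcs G}"
  by (auto simp: neighbours_def induce_subgraph_def arcs_ends_conv)

lemma letter_graph_elimination:
  assumes "finite W" "W \<subseteq> pverts G" and c: "c \<in> pverts G \<rightarrow> {1..k}"
    and elim: "\<forall>W \<subseteq> pverts G. W \<noteq> {} \<longrightarrow>
        (\<exists>x \<in> W. neighbours (with_proj G \<restriction> W) x = {} \<or>
           (\<exists>i \<in> {1..k}. neighbours (with_proj G \<restriction> W) x = {y \<in> W - {x}. c y = i}))"
  shows "\<exists>l r. represents (k * (k + 1)) (threshold_decoder k) (\<lambda>u v. (u, v) \<in> parcs G) W l r \<and>
    (\<forall>v\<in>W. letter_colour k (l v) = c v)"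
  using assms(1,2)
proof (induction W rule: finite_remove_induct)
  case empty
  show ?case by (simp add: represents_def)
next
  case (remove W)
  obtain x where x: "x \<in> W" "neighbours (with_proj G \<restriction> W) x = {} \<or>
      (\<exists>i \<in> {1..k}. neighbours (with_proj G \<restriction> W) x = {y \<in> W - {x}. c y = i})"
    using elim remove.hyps(2) remove.prems by blast
  have c_range: "c y \<in> {1..k}" if "y \<in> W" for y using c that remove.prems by blast
  obtain t where t: "t \<le> k" "\<And>y. y \<in> W - {x} \<Longrightarrow> (x, y) \<in> parcs G \<longleftrightarrow> c y = t"
  proof (cases "neighbours (with_proj G \<restriction> W) x = {}")
    case True
    then show thesis using that[of 0] c_range x(1) by (fastforce simp: neighbours_induced)
  next
    case False
    then obtain i where "i \<in> {1..k}" "neighbours (with_proj G \<restriction> W) x = {y \<in> W - {x}. c y = i}"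
      using x(2) by blast
    then show thesis using that[of i] x(1) by (auto simp: neighbours_induced)
  qed
  from remove.IH[OF x(1)] remove.prems obtain l r where
    lr: "represents (k * (k + 1)) (threshold_decoder k) (\<lambda>u v. (u, v) \<in> parcs G) (W - {x}) l r"
    and col: "\<And>v. v \<in> W - {x} \<Longrightarrow> letter_colour k (l v) = c v" by blast
  obtain e where cx: "c x = Suc e" "e < k" using c_range[OF x(1)] by (cases "c x") auto
  define a where "a = t * k + e"
  have a: "letter_colour k a = c x" "letter_target k a = t"
    using cx by (simp_all add: a_def letter_colour_def letter_target_def)
  have "t * k + e < (t + 1) * k" using cx by simp
  also have "\<dots> \<le> (k + 1) * k" using t(1) by (intro mult_le_mono1) simp
  finally have a_less: "a < k * (k + 1)" by (simp add: a_def mult.commute)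
  let ?l = "l(x := a)" and ?r = "\<lambda>v. if v = x then 0 else Suc (r v)"
  have "represents (k * (k + 1)) (threshold_decoder k) (\<lambda>u v. (u, v) \<in> parcs G) W ?l ?r"
    unfolding represents_def
  proof (intro conjI ballI impI)
    show "inj_on ?r W" using lr by (auto simp: represents_def inj_on_def)
    show "?l v < k * (k + 1)" if "v \<in> W" for v using lr a_less that by (auto simp: represents_def)
    fix u v assume uv: "u \<in> W" "v \<in> W" "?r u < ?r v"
    then have v: "v \<noteq> x" by (auto split: if_splits)
    show "(u, v) \<in> parcs G \<longleftrightarrow> threshold_decoder k (?l u) (?l v)"
    proof (cases "u = x")
      case True
      then show ?thesis using t(2)[of v] a(2) col[of v] v uv by (auto simp: threshold_decoder_def)
    next
      case False
      then show ?thesis using lr v uv by (simp add: represents_def)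
    qed
  qed
  moreover have "\<forall>v\<in>W. letter_colour k (?l v) = c v" using col a(1) by auto
  ultimately show ?case by blast
qed

lemma k_threshold_graph_iff_letter_graph:
  assumes "pair_graph G"
  shows "k_threshold_graph k G \<longleftrightarrow>
    letter_graph (k * (k + 1)) (threshold_decoder k) (\<lambda>u v. (u, v) \<in> parcs G) (pverts G)"
proof
  interpret pair_graph G by (rule assms)
  assume "k_threshold_graph k G"
  then obtain c where c: "c \<in> pverts G \<rightarrow> {1..k}" "\<forall>W \<subseteq> pverts G. W \<noteq> {} \<longrightarrow>
        (\<exists>x \<in> W. neighbours (with_proj G \<restriction> W) x = {} \<or>
           (\<exists>i \<in> {1..k}. neighbours (with_proj G \<restriction> W) x = {y \<in> W - {x}. c y = i}))"
    unfolding k_threshold_graph_def by (elim conjE bexE)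
  show "letter_graph (k * (k + 1)) (threshold_decoder k) (\<lambda>u v. (u, v) \<in> parcs G) (pverts G)"
    using letter_graph_elimination[OF pair_finite_verts order_refl c]
    unfolding letter_graph_def by blast
next
  interpret pair_graph G by (rule assms)
  assume "letter_graph (k * (k + 1)) (threshold_decoder k) (\<lambda>u v. (u, v) \<in> parcs G) (pverts G)"
  then obtain l r where
    lr: "represents (k * (k + 1)) (threshold_decoder k) (\<lambda>u v. (u, v) \<in> parcs G) (pverts G) l r"
    unfolding letter_graph_def by blast
  have inj: "inj_on r (pverts G)" and l: "\<And>v. v \<in> pverts G \<Longrightarrow> l v < k * (k + 1)"
    and adj: "\<And>u v. u \<in> pverts G \<Longrightarrow> v \<in> pverts G \<Longrightarrow> r u < r v \<Longrightarrow>
      (u, v) \<in> parcs G \<longleftrightarrow> letter_target k (l u) = letter_colour k (l v)"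
    using lr unfolding represents_def threshold_decoder_def by blast+
  let ?c = "letter_colour k \<circ> l"
  have range: "?c v \<in> {1..k}" if "v \<in> pverts G" for v
    using l[OF that] by (cases "k = 0") (auto simp: letter_colour_def Suc_le_eq)
  have "\<exists>x \<in> W. neighbours (with_proj G \<restriction> W) x = {} \<or>
      (\<exists>i \<in> {1..k}. neighbours (with_proj G \<restriction> W) x = {y \<in> W - {x}. ?c y = i})"
    if W: "W \<subseteq> pverts G" "W \<noteq> {}" for W
  proof -
    obtain x where x: "x \<in> W" and min: "\<And>y. y \<in> W \<Longrightarrow> r x \<le> r y"
      using ex_has_least_nat[of "\<lambda>x. x \<in> W" _ r] W(2) by blast
    have "r x < r y" if "y \<in> W - {x}" for y
      using min[of y] inj x that W(1) by (metis DiffD1 DiffD2 inj_onD insertI1 le_neq_implies_less subsetD)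
    then have adj_x: "(x, y) \<in> parcs G \<longleftrightarrow> letter_target k (l x) = ?c y" if "y \<in> W - {x}" for y
      using adj[of x y] x that W(1) by auto
    have "(x, x) \<notin> parcs G" using no_loops[of "(x, x)"] by auto
    then have "y \<in> neighbours (with_proj G \<restriction> W) x \<longleftrightarrow>
        y \<in> {y \<in> W - {x}. ?c y = letter_target k (l x)}" for y
      using x adj_x[of y] by (cases "y = x") (auto simp: neighbours_induced)
    then have nb: "neighbours (with_proj G \<restriction> W) x = {y \<in> W - {x}. ?c y = letter_target k (l x)}"
      by blast
    have le: "letter_target k (l x) \<le> k"
      using l[of x] x W(1) by (auto simp: letter_target_def mult.commute less_mult_imp_div_less less_Suc_eq_le[symmetric])
    show ?thesis
    proof (cases "letter_target k (l x) = 0")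
      case True
      then have "neighbours (with_proj G \<restriction> W) x = {}"
        unfolding nb by (simp add: letter_colour_def)
      then show ?thesis using x by blast
    next
      case False
      then have "letter_target k (l x) \<in> {1..k}" using le by simp
      then show ?thesis using x nb by blast
    qed
  qed
  then have "\<forall>W \<subseteq> pverts G. W \<noteq> {} \<longrightarrow> (\<exists>x \<in> W. neighbours (with_proj G \<restriction> W) x = {} \<or>
      (\<exists>i \<in> {1..k}. neighbours (with_proj G \<restriction> W) x = {y \<in> W - {x}. ?c y = i}))"
    by simp
  moreover have "?c \<in> pverts G \<rightarrow> {1..k}" using range by blast
  ultimately show "k_threshold_graph k G"
    unfolding k_threshold_graph_def using assms by blast
qed

theorem theorem2:
  fixes k :: nat
  shows "\<exists>P. ram_decides P (k_threshold_graph k) \<and> ram_time P (\<lambda>n. real n ^ 3) \<and> ram_log_words P"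
proof -
  obtain prog where decides: "ram_decides prog (\<lambda>G. letter_graph (k * (k + 1)) (threshold_decoder k)
        (\<lambda>u v. (u, v) \<in> parcs G) (pverts G))"
    and prog: "ram_time prog (\<lambda>n. real n ^ 3)" "ram_log_words prog"
    by (rule letter_graph_machine)
  have "ram_decides prog (k_threshold_graph k)"
    unfolding ram_decides_def
  proof (intro allI impI)
    fix n G
    assume G: "input_graph n G"
    then have "k_threshold_graph k G \<longleftrightarrow>
        letter_graph (k * (k + 1)) (threshold_decoder k) (\<lambda>u v. (u, v) \<in> parcs G) (pverts G)"
      by (intro k_threshold_graph_iff_letter_graph) (simp add: input_graph_def)
    then show "\<exists>t. halted prog (ram_run prog (graph_input n G) t) \<and>
        registers (ram_run prog (graph_input n G) t) 0 = of_bool (k_threshold_graph k G)"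
      using decides G unfolding ram_decides_def by presburger
  qed
  with prog show ?thesis by blast
qed

end
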